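(* Let $X=(x_0,x_1)$ be a bounded interval. If $\zeta\in\mathrm{Reg}_+(X)$ and $\omega\in\mathbb{R}\setminus\Sigma_\zeta$, then $g_\zeta^\omega\in K$. If in addition $\zeta$ has bounded variation, then $g_\zeta^\omega\in\mathrm{Aut}\,\mathbb{P}$, i.e. $g^\omega_\zeta$ is non-constant.
   Context: $\mathbb{D}$ is the open unit disk, $S^1$ the unit circle. $\mathrm{Aut}\,\mathbb{P}$ is the set of all holomorphic bijections of $\mathbb{D}$, i.e. the maps $\varphi_{\mu,\rho}(\xi)=\mu\frac{\xi+\rho}{1+\bar\rho\xi}$ with $\mu\in S^1$, $\rho\in\mathbb{D}$. $K$ is the closure of $\mathrm{Aut}\,\mathbb{P}$ for uniform convergence on compact subsets of $\mathbb{D}$; it consists of $\mathrm{Aut}\,\mathbb{P}$ together with all constant maps $\mathbf{c}_\sigma(\xi)=\sigma$, $\sigma\in S^1$. $\mathrm{Step}(X)$ is the set of piecewise-constant complex-valued functions on $X$ with finitely many discontinuities; $\mathrm{Reg}(X)$ (regulated functions) is the closure of $\mathrm{Step}(X)$ in $L^\infty(X)$; $\mathrm{Reg}_+(X)=\{f\in\mathrm{Reg}(X): \exists\varepsilon>0,\ f(x)>\varepsilon\ \forall x\in X\}$. One-sided limits are written $f(x\pm)$. For $\omega\in\mathbb{R}\setminus\{0\}$ put $u^{\ell}=\frac12\bigl(u-\frac{1}{i\omega}u'\bigr)$ and $u^{\rm r}=\frac12\bigl(u+\frac{1}{i\omega}u'\bigr)$. The exceptional set $\Sigma_\zeta$: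 let $A_{\zeta,0}:L^2(X)\to L^2(X)$ be the compact operator that sends $\psi$ to the unique $A_{\zeta,0}\psi\in W^{1,2}(X)$ such that $\langle\zeta A_{\zeta,0}\psi,v\rangle_{L^2}+\langle\zeta (A_{\zeta,0}\psi)',v'\rangle_{L^2}=\langle\zeta\psi,v\rangle_{L^2}$ for all $v\in W^{1,2}(X)$; then $\Sigma_\zeta=\{\pm\sqrt{\lambda^{-1}-1}:\lambda\in\operatorname{spec}A_{\zeta,0}\cap(0,1]\}$, a countable set containing $0$. For $\zeta\in\mathrm{Reg}_+(X)$, $\omega\in\mathbb{R}\setminus\Sigma_\zeta$ and $\xi\in\mathbb{D}$ the problem $(\zeta u')'+\omega^2\zeta u=0$ on $X$, $u^{\rm r}(x_0+)=1$, $u^{\ell}(x_1-)=\xi u^{\rm r}(x_1-)$ has a unique solution $u$ with $u$ and $\zeta u'$ absolutely continuous (equation holding a.e.); one defines $g_\zeta^\omega(\xi)=u^{\ell}(x_0+)$. *)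

theory Defs
  imports "HOL-Analysis.Analysis"
begin

text \<open>
  Elements of \<open>L\<^sup>2(X)\<close> and \<open>L\<^sup>\<infinity>(X)\<close> are represented by functions that are measurable on \<open>X\<close>, with
  equality almost everywhere on \<open>X\<close> in place of equality of classes.
\<close>


section \<open>Automorphisms of the disk\<close>

abbreviation disk :: "complex set" where
  "disk \<equiv> ball 0 1"

text \<open>
  A map on the disk is represented by a total function; the two sets below depend only on the values
  on the disk.
\<close>

definition Aut_disk :: "(complex \<Rightarrow> complex) set" where
  "Aut_disk = {f. f holomorphic_on disk \<and> bij_betw f disk disk}"

text \<open>
  The sets of all \<open>h\<close> with \<open>dist (h z) (f z) < e\<close> for \<open>z \<in> C\<close>, where \<open>C\<close> is a compact subset of the
  disk and \<open>e > 0\<close>, form a neighbourhood base at \<open>f\<close> for the topology of uniform convergence on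
  compact subsets of the disk.
\<close>

definition Aut_disk_closure :: "(complex \<Rightarrow> complex) set" where
  "Aut_disk_closure =
    {f. \<forall>C e. compact C \<and> C \<subseteq> disk \<and> e > 0 \<longrightarrow> (\<exists>\<phi>\<in>Aut_disk. \<forall>z\<in>C. dist (\<phi> z) (f z) < e)}"


section \<open>Regulated functions and bounded variation\<close>

definition Step :: "real set \<Rightarrow> (real \<Rightarrow> complex) set" where
  "Step X = {f. \<exists>F. finite F \<and> (\<forall>I\<in>components (X - F). f constant_on I)}"

definition Reg :: "real set \<Rightarrow> (real \<Rightarrow> complex) set" where
  "Reg X = {f \<in> borel_measurable (lebesgue_on X).
     \<forall>e>0. \<exists>s\<in>Step X. AE x in lebesgue_on X. norm (f x - s x) \<le> e}"

definition Reg_plus :: "real set \<Rightarrow> (real \<Rightarrow> real) set" where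
  "Reg_plus X = {f. (\<lambda>x. complex_of_real (f x)) \<in> Reg X \<and> (\<exists>\<epsilon>>0. \<forall>x\<in>X. f x > \<epsilon>)}"

definition bounded_variation_on :: "real set \<Rightarrow> (real \<Rightarrow> real) \<Rightarrow> bool" where
  "bounded_variation_on X f \<longleftrightarrow>
    (\<exists>M. \<forall>n t. (\<forall>i\<le>n. t i \<in> X) \<and> (\<forall>i<n. t i \<le> t (Suc i)) \<longrightarrow>
       (\<Sum>i<n. \<bar>f (t (Suc i)) - f (t i)\<bar>) \<le> M)"

text \<open>
  Since membership in \<open>Reg X\<close> is insensitive to null sets, so should be bounded variation: the class
  of \<open>f\<close> has bounded variation if one of its representatives does.
\<close>

definition ess_bounded_variation_on :: "real set \<Rightarrow> (real \<Rightarrow> real) \<Rightarrow> bool" where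
  "ess_bounded_variation_on X f \<longleftrightarrow>
    (\<exists>h. bounded_variation_on X h \<and> (AE x in lebesgue_on X. h x = f x))"

text \<open>
  The filters for the one-sided limits \<open>f(a+)\<close> and \<open>f(a-)\<close> of functions that are determined, or
  defined, only almost everywhere.
\<close>

definition ess_at_right :: "real \<Rightarrow> real filter" where
  "ess_at_right a = inf (at_right a) (ae_filter lebesgue)"

definition ess_at_left :: "real \<Rightarrow> real filter" where
  "ess_at_left a = inf (at_left a) (ae_filter lebesgue)"


section \<open>The exceptional set\<close>

definition L2 :: "real set \<Rightarrow> (real \<Rightarrow> complex) set" where
  "L2 X = {f \<in> borel_measurable (lebesgue_on X). integrable (lebesgue_on X) (\<lambda>x. (norm (f x))\<^sup>2)}"

definition L2_inner :: "real set \<Rightarrow> (real \<Rightarrow> complex) \<Rightarrow> (real \<Rightarrow> complex) \<Rightarrow> complex" where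
  "L2_inner X f h = (LINT x|lebesgue_on X. f x * cnj (h x))"

definition L2_norm :: "real set \<Rightarrow> (real \<Rightarrow> complex) \<Rightarrow> real" where
  "L2_norm X f = sqrt (LINT x|lebesgue_on X. (norm (f x))\<^sup>2)"

definition test_function :: "real set \<Rightarrow> (real \<Rightarrow> real) \<Rightarrow> bool" where
  "test_function X \<eta> \<longleftrightarrow>
    (\<forall>n x. (deriv ^^ n) \<eta> differentiable (at x)) \<and>
    compact (closure {x. \<eta> x \<noteq> 0}) \<and> closure {x. \<eta> x \<noteq> 0} \<subseteq> X"

definition weak_deriv :: "real set \<Rightarrow> (real \<Rightarrow> complex) \<Rightarrow> (real \<Rightarrow> complex) \<Rightarrow> bool" where
  "weak_deriv X f f' \<longleftrightarrow>
    (\<forall>\<eta>. test_function X \<eta> \<longrightarrow>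
      (LINT x|lebesgue_on X. deriv \<eta> x *\<^sub>R f x) = - (LINT x|lebesgue_on X. \<eta> x *\<^sub>R f' x))"

text \<open>
  \<open>W12 X\<close> is the Sobolev space \<open>W\<^sup>1\<^sup>,\<^sup>2(X)\<close>, given as the set of pairs of a function and its weak
  derivative. The weak derivative is determined by the function almost everywhere.
\<close>

definition W12 :: "real set \<Rightarrow> ((real \<Rightarrow> complex) \<times> (real \<Rightarrow> complex)) set" where
  "W12 X = {(f, f'). f \<in> L2 X \<and> f' \<in> L2 X \<and> weak_deriv X f f'}"

text \<open>The choice operator only picks a representative of the unique class.\<close>

definition A_op :: "real set \<Rightarrow> (real \<Rightarrow> real) \<Rightarrow> (real \<Rightarrow> complex) \<Rightarrow> (real \<Rightarrow> complex)" where
  "A_op X \<zeta> \<psi> =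
    (SOME \<phi>. \<exists>\<phi>'. (\<phi>, \<phi>') \<in> W12 X \<and>
      (\<forall>(v, v')\<in>W12 X.
         L2_inner X (\<lambda>x. \<zeta> x *\<^sub>R \<phi> x) v + L2_inner X (\<lambda>x. \<zeta> x *\<^sub>R \<phi>' x) v'
           = L2_inner X (\<lambda>x. \<zeta> x *\<^sub>R \<psi> x) v))"

text \<open>
  The spectrum of an operator on \<open>L\<^sup>2(X)\<close>: the complement of the set of all \<open>z\<close> for which \<open>T - z\<close> is
  surjective and bounded below, that is, has a bounded inverse.
\<close>

definition L2_spectrum ::
  "real set \<Rightarrow> ((real \<Rightarrow> complex) \<Rightarrow> (real \<Rightarrow> complex)) \<Rightarrow> complex set" where
  "L2_spectrum X T =
    {z. \<not> ((\<forall>f\<in>L2 X. \<exists>h\<in>L2 X. AE x in lebesgue_on X. T h x - z * h x = f x) \<and>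
           (\<exists>C. \<forall>h\<in>L2 X. L2_norm X h \<le> C * L2_norm X (\<lambda>x. T h x - z * h x)))}"

definition Sigma_exc :: "real set \<Rightarrow> (real \<Rightarrow> real) \<Rightarrow> real set" where
  "Sigma_exc X \<zeta> =
    {s. \<exists>l::real. complex_of_real l \<in> L2_spectrum X (A_op X \<zeta>) \<and> 0 < l \<and> l \<le> 1 \<and>
          (s = sqrt (inverse l - 1) \<or> s = - sqrt (inverse l - 1))}"


section \<open>The boundary value problem\<close>

definition absolutely_continuous_on :: "real set \<Rightarrow> (real \<Rightarrow> complex) \<Rightarrow> bool" where
  "absolutely_continuous_on X f \<longleftrightarrow>
    (\<forall>e>0. \<exists>d>0. \<forall>P :: (real \<times> real) set.
       finite P \<and> (\<forall>(a, b)\<in>P. a \<le> b \<and> {a..b} \<subseteq> X) \<and>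
       disjoint_family_on (\<lambda>(a, b). {a<..<b}) P \<and> (\<Sum>(a, b)\<in>P. b - a) < d \<longrightarrow>
       (\<Sum>(a, b)\<in>P. norm (f b - f a)) < e)"

definition u_left :: "real \<Rightarrow> (real \<Rightarrow> complex) \<Rightarrow> real \<Rightarrow> complex" where
  "u_left \<omega> u x = 1 / 2 * (u x - 1 / (\<i> * complex_of_real \<omega>) * vector_derivative u (at x))"

definition u_right :: "real \<Rightarrow> (real \<Rightarrow> complex) \<Rightarrow> real \<Rightarrow> complex" where
  "u_right \<omega> u x = 1 / 2 * (u x + 1 / (\<i> * complex_of_real \<omega>) * vector_derivative u (at x))"

text \<open>
  The derivative of \<open>u\<close> exists only almost everywhere, so \<open>\<zeta> u'\<close> is absolutely continuous in the sense
  that it agrees almost everywhere with an absolutely continuous function \<open>p\<close>; the differential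
  equation is \<open>p' + \<omega>\<^sup>2 \<zeta> u = 0\<close>. Differentiability of \<open>u\<close> is stated explicitly because
  \<^const>\<open>vector_derivative\<close> is unspecified elsewhere.
\<close>

definition is_solution ::
  "real \<Rightarrow> real \<Rightarrow> (real \<Rightarrow> real) \<Rightarrow> real \<Rightarrow> complex \<Rightarrow> (real \<Rightarrow> complex) \<Rightarrow> bool" where
  "is_solution x0 x1 \<zeta> \<omega> \<xi> u \<longleftrightarrow>
    absolutely_continuous_on {x0<..<x1} u \<and>
    (\<exists>p. absolutely_continuous_on {x0<..<x1} p \<and>
       (AE x in lebesgue_on {x0<..<x1}.
          u differentiable (at x) \<and> p x = \<zeta> x *\<^sub>R vector_derivative u (at x)) \<and>
       (AE x in lebesgue_on {x0<..<x1}.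
          \<exists>p'. (p has_vector_derivative p') (at x) \<and> p' + (\<omega>\<^sup>2 * \<zeta> x) *\<^sub>R u x = 0)) \<and>
    (u_right \<omega> u \<longlongrightarrow> 1) (ess_at_right x0) \<and>
    (\<exists>r. (u_right \<omega> u \<longlongrightarrow> r) (ess_at_left x1) \<and> (u_left \<omega> u \<longlongrightarrow> \<xi> * r) (ess_at_left x1))"

text \<open>The value \<open>u\<^sup>l(x\<^sub>0+)\<close> of the solution, as a function of \<open>\<xi>\<close>.\<close>

definition g_map :: "real \<Rightarrow> real \<Rightarrow> (real \<Rightarrow> real) \<Rightarrow> real \<Rightarrow> complex \<Rightarrow> complex" where
  "g_map x0 x1 \<zeta> \<omega> \<xi> =
    (THE w. \<exists>u. is_solution x0 x1 \<zeta> \<omega> \<xi> u \<and> (u_left \<omega> u \<longlongrightarrow> w) (ess_at_right x0))"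

end

theory Submission
  imports Defs
begin

text \<open>
  Write the equation as the system \<open>u' = p / \<zeta>\<close>, \<open>p' = - \<omega>\<^sup>2 \<zeta> u\<close>. The flux \<open>Im (cnj u * p)\<close> is constant, and up to
  the factor \<open>\<omega>\<close> it equals \<open>\<zeta> (|u\<^sup>r|\<^sup>2 - |u\<^sup>l|\<^sup>2)\<close>. The linear map from the data \<open>(u\<^sup>r, u\<^sup>l)\<close> at \<open>x1-\<close> to
  those at \<open>x0+\<close> is therefore a multiple of an element of \<open>U(1,1)\<close>, and \<open>g\<close> is the Moebius
  transformation that it induces, an automorphism of the disk for every \<open>\<omega> \<noteq> 0\<close>; and \<open>0\<close> lies in
  the exceptional set. Regulatedness of \<open>\<zeta>\<close> provides the one-sided limits at the end points, and
  continuity at almost every point up to null sets, which makes the solution of the integral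
  equation differentiable almost everywhere.
\<close>

section \<open>Absolutely continuous functions with vanishing derivative\<close>

text \<open>Two features of the setting shape the argument. First, \<open>u'\<close> exists and
  \<open>\<zeta>\<close> is determined only up to null sets, so end values are limits along filters
  that ignore null sets, and constancy of the flux rests on absolute continuity: a derivative that
  vanishes almost everywhere would not suffice by itself. Second, the boundary conditions sit at
  both ends. They are reduced to initial value problems started at \<open>x1\<close>, where the
  condition u^l = \<xi> u^r fixes the data up to a factor; the factor is then chosen to make
  u^r(x0+) equal to 1. That this choice is possible, and that the reflected value is unique, both
  follow from the sign of the flux for \<xi> in the disk. The end values \<open>z0\<close> and
  \<open>z1\<close> of \<open>\<zeta>\<close> enter because the conserved quantity carries the
  weight \<open>\<zeta>\<close>; they make the multiplier of the \<open>U(1,1)\<close> form equal to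
  \<open>z1 / z0\<close>.\<close>

lemma absolutely_continuous_on_diff_eq_0:
  fixes f :: "real \<Rightarrow> complex"
  assumes ac: "absolutely_continuous_on {l<..<r} f"
    and deriv: "AE x in lebesgue_on {l<..<r}. (f has_vector_derivative 0) (at x)"
    and ab: "l < a" "a \<le> b" "b < r"
  shows "f b = f a"
proof -
  have "norm (f b - f a) \<le> 0 + e" if "e > 0" for e
  proof -
    \<comment> \<open>Half of \<open>e\<close> is reserved for the intervals with tags off the null
      set, where \<open>f\<close> grows at rate at most \<open>c\<close>. The summand 1 keeps the
      denominator positive when \<open>a = b\<close>.\<close>
    define c where "c = e / (2 * (1 + (b - a)))"
    have c: "c > 0" "c * (b - a) \<le> e / 2"
      using that ab by (auto simp: c_def field_simps)
    from ac that obtain d where d: "d > 0" and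
      dP: "\<And>P. finite P \<Longrightarrow> (\<And>u v. (u, v) \<in> P \<Longrightarrow> u \<le> v \<and> {u..v} \<subseteq> {l<..<r}) \<Longrightarrow>
         disjoint_family_on (\<lambda>(u, v). {u<..<v}) P \<Longrightarrow> (\<Sum>(u, v)\<in>P. v - u) < d \<Longrightarrow>
         (\<Sum>(u, v)\<in>P. norm (f v - f u)) < e / 2"
      unfolding absolutely_continuous_on_def by (drule_tac x="e/2" in spec) (force simp: split_def)
    define N where "N = {x \<in> {l<..<r}. \<not> (f has_vector_derivative 0) (at x)}"
    have "AE x in lebesgue. x \<in> {l<..<r} \<longrightarrow> (f has_vector_derivative 0) (at x)"
      using deriv by (subst (asm) AE_restrict_space_iff) auto
    then have "N \<in> null_sets lebesgue"
      unfolding eventually_ae_filter N_def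
      by (elim bexE) (rule null_sets_completion_subset, auto)
    then have "negligible N"
      by (simp add: negligible_iff_null_sets)
    \<comment> \<open>The indicator of the exceptional set has integral 0, so in a fine enough
      tagged division the intervals with tags in \<open>N\<close> have total length below
      \<open>d\<close>. Riemann sums thus take the place of a covering argument.\<close>
    then have "(indicator N has_integral (0::real)) (cbox a b)"
      by (simp add: negligible_def)
    then obtain g1 where g1: "gauge g1" and g1p: "\<And>p. p tagged_division_of (cbox a b) \<Longrightarrow> g1 fine p \<Longrightarrow>
        norm ((\<Sum>(x,K)\<in>p. measure lborel K *\<^sub>R (indicator N x :: real)) - 0) < d"
      using d unfolding has_integral by metis
    have "\<exists>s>0. x \<in> {l<..<r} - N \<longrightarrow> (\<forall>y. \<bar>y - x\<bar> < s \<longrightarrow> norm (f y - f x) \<le> c * \<bar>y - x\<bar>)" for x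
    proof (cases "x \<in> {l<..<r} - N")
      case True
      then have "(f has_derivative (\<lambda>_. 0)) (at x)"
        by (auto simp: N_def has_vector_derivative_def)
      then show ?thesis
        using c unfolding has_derivative_at_alt by auto
    qed (auto intro: exI[of _ 1])
    then obtain s where s: "\<And>x. s x > 0" and
      sx: "\<And>x y. x \<in> {l<..<r} - N \<Longrightarrow> \<bar>y - x\<bar> < s x \<Longrightarrow> norm (f y - f x) \<le> c * \<bar>y - x\<bar>"
      by metis
    \<comment> \<open>One division fine for both gauges: \<open>g1\<close> controls the intervals
      tagged in \<open>N\<close>, and \<open>s\<close> makes every other interval lie in the ball
      around its tag where the rate \<open>c\<close> is valid.\<close>
    have "gauge (\<lambda>x. g1 x \<inter> ball x (s x))"
      using g1 s by (intro gauge_Int gauge_ball_dependent) auto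
    then obtain p where p: "p tagged_division_of {a..b}" and fine: "(\<lambda>x. g1 x \<inter> ball x (s x)) fine p"
      using fine_division_exists_real by blast
    have finp: "finite p"
      using p by blast
    have K: "\<exists>u v. K = {u..v} \<and> u \<le> x \<and> x \<le> v \<and> a \<le> u \<and> v \<le> b" if "(x, K) \<in> p" for x K
    proof -
      have "\<exists>u v. K = cbox u v"
        by (rule tagged_division_ofD(4)[OF p that])
      then obtain u v where uv: "K = {u..v}"
        by auto
      have "x \<in> K" "K \<subseteq> {a..b}"
        using tagged_division_ofD(2,3)[OF p that] .
      then have "u \<le> x \<and> x \<le> v \<and> a \<le> u \<and> v \<le> b"
        unfolding uv by auto
      with uv show ?thesis
        by blast
    qed
    define I where "I = (\<lambda>K::real set. (Inf K, Sup K))"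
    \<comment> \<open>Degenerate intervals are dropped: they carry no increment, and without them
      disjoint interiors force distinct members to have distinct pairs of endpoints. The family can
      then be passed as a set \<open>P\<close> of pairs to the definition of absolute
      continuity.\<close>
    define q where "q = {(x, K) \<in> p. x \<in> N \<and> measure lborel K \<noteq> 0}"
    have fin: "finite q"
      using finp by (rule finite_subset[rotated]) (auto simp: q_def)
    have qK: "\<exists>u v. K = {u..v} \<and> u < v \<and> l < u \<and> v < r \<and> I K = (u, v)" if "(x, K) \<in> q" for x K
    proof -
      have "(x, K) \<in> p" "measure lborel K \<noteq> 0"
        using that by (auto simp: q_def)
      with K obtain u v where "K = {u..v}" "u \<le> x" "x \<le> v" "a \<le> u" "v \<le> b"
        by blast
      with \<open>measure lborel K \<noteq> 0\<close> ab show ?thesis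
        by (intro exI[of _ u] exI[of _ v]) (auto simp: I_def)
    qed
    have disj: "{fst (I K1)<..<snd (I K1)} \<inter> {fst (I K2)<..<snd (I K2)} = {}"
      if "(x1, K1) \<in> q" "(x2, K2) \<in> q" "(x1, K1) \<noteq> (x2, K2)" for x1 x2 K1 K2
    proof -
      have "interior K1 \<inter> interior K2 = {}"
        using that p by (intro tagged_division_ofD(5)[OF p]) (auto simp: q_def)
      with qK[OF that(1)] qK[OF that(2)] show ?thesis
        by auto
    qed
    have inj: "inj_on (\<lambda>(x, K). I K) q"
    proof (rule inj_onI, clarify)
      fix x1 K1 x2 K2
      assume *: "(x1, K1) \<in> q" "(x2, K2) \<in> q" "I K1 = I K2"
      show "x1 = x2 \<and> K1 = K2"
      proof (rule ccontr)
        assume "\<not> (x1 = x2 \<and> K1 = K2)"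
        with disj[OF *(1,2)] * have "{fst (I K1)<..<snd (I K1)} = {}"
          by auto
        with qK[OF *(1)] show False
          by auto
      qed
    qed
    define P where "P = (\<lambda>(x, K). I K) ` q"
    have sumP: "(\<Sum>(u, v)\<in>P. h u v) = (\<Sum>(x, K)\<in>q. h (Inf K) (Sup K))" for h :: "real \<Rightarrow> real \<Rightarrow> real"
      unfolding P_def by (subst sum.reindex[OF inj]) (simp add: I_def split_def)
    have "(\<Sum>(x, K)\<in>q. Sup K - Inf K) = (\<Sum>(x, K)\<in>q. measure lborel K *\<^sub>R indicator N x)"
      using qK by (intro sum.cong) (fastforce simp: q_def I_def)+
    also have "\<dots> = (\<Sum>(x, K)\<in>p. measure lborel K *\<^sub>R indicator N x)"
      using finp by (intro sum.mono_neutral_left) (auto simp: q_def indicator_def)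
    also have "\<dots> < d"
      using g1p[of p] p fine by (force simp: fine_def)
    finally have "(\<Sum>(u, v)\<in>P. v - u) < d"
      by (simp add: sumP)
    moreover have "disjoint_family_on (\<lambda>(u, v). {u<..<v}) P"
      unfolding disjoint_family_on_def
    proof (intro ballI impI)
      fix m n assume "m \<in> P" "n \<in> P" "m \<noteq> n"
      then obtain x1 K1 x2 K2 where "(x1, K1) \<in> q" "m = I K1" "(x2, K2) \<in> q" "n = I K2"
        by (auto simp: P_def)
      with disj \<open>m \<noteq> n\<close> show "(case m of (u, v) \<Rightarrow> {u<..<v}) \<inter> (case n of (u, v) \<Rightarrow> {u<..<v}) = {}"
        by (force simp: split_def)
    qed
    moreover have "u \<le> v \<and> {u..v} \<subseteq> {l<..<r}" if "(u, v) \<in> P" for u v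
      using that qK by (fastforce simp: P_def)
    ultimately have "(\<Sum>(u, v)\<in>P. norm (f v - f u)) < e / 2"
      using fin by (intro dP) (auto simp: P_def)
    then have bad: "(\<Sum>(x, K)\<in>q. norm (f (Sup K) - f (Inf K))) < e / 2"
      by (simp add: sumP)
    \<comment> \<open>The tag lies between the endpoints, so off \<open>N\<close> the increments to
      its left and right add up to at most \<open>c\<close> times the length of the
      interval.\<close>
    have "norm (f (Sup K) - f (Inf K)) \<le>
        (if (x, K) \<in> q then norm (f (Sup K) - f (Inf K)) else 0) + c * (Sup K - Inf K)"
      if xK: "(x, K) \<in> p" for x K
    proof -
      obtain u v where uv: "K = {u..v}" "u \<le> x" "x \<le> v" "a \<le> u" "v \<le> b"
        using K[OF xK] by blast
      show ?thesis
      proof (cases "x \<in> N")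
        case True
        then show ?thesis
          using uv xK c by (auto simp: q_def)
      next
        case False
        have "u \<in> K" "v \<in> K" "K \<subseteq> ball x (s x)"
          using uv fine xK by (auto simp: fine_def)
        then have "\<bar>u - x\<bar> < s x" "\<bar>v - x\<bar> < s x"
          by (auto simp: dist_real_def subset_iff abs_minus_commute)
        then have "norm (f u - f x) \<le> c * (x - u)" "norm (f v - f x) \<le> c * (v - x)"
          using sx[of x u] sx[of x v] False uv ab by auto
        moreover have "norm (f v - f u) \<le> norm (f v - f x) + norm (f u - f x)"
          by (metis norm_triangle_ineq4 diff_diff_eq2 diff_add_cancel add.commute add_diff_cancel_left)
        ultimately show ?thesis
          using uv False by (auto simp: q_def algebra_simps)
      qed
    qed
    then have "(\<Sum>(x, K)\<in>p. norm (f (Sup K) - f (Inf K))) \<le>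
       (\<Sum>(x, K)\<in>p. (if (x, K) \<in> q then norm (f (Sup K) - f (Inf K)) else 0) + c * (Sup K - Inf K))"
      by (intro sum_mono) auto
    also have "\<dots> = (\<Sum>(x, K)\<in>p. if (x, K) \<in> q then norm (f (Sup K) - f (Inf K)) else 0) +
        c * (\<Sum>(x, K)\<in>p. Sup K - Inf K)"
      by (simp add: split_def sum.distrib sum_distrib_left)
    also have "(\<Sum>(x, K)\<in>p. Sup K - Inf K) = b - a"
      using additive_tagged_division_1[OF _ p, of "\<lambda>x. x"] ab by simp
    also have "(\<Sum>(x, K)\<in>p. if (x, K) \<in> q then norm (f (Sup K) - f (Inf K)) else 0) =
        (\<Sum>(x, K)\<in>q. norm (f (Sup K) - f (Inf K)))"
      using finp by (intro sum.mono_neutral_cong_right) (auto simp: q_def split: if_splits)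
    finally have "(\<Sum>(x, K)\<in>p. norm (f (Sup K) - f (Inf K))) \<le> e"
      using bad c by linarith
    moreover have "f b - f a = (\<Sum>(x, K)\<in>p. f (Sup K) - f (Inf K))"
      using additive_tagged_division_1[OF _ p, of f] ab by simp
    moreover have "norm (\<Sum>(x, K)\<in>p. f (Sup K) - f (Inf K)) \<le> (\<Sum>(x, K)\<in>p. norm (f (Sup K) - f (Inf K)))"
      by (rule sum_norm_le) auto
    ultimately show ?thesis
      by simp
  qed
  then show ?thesis
    by (metis field_le_epsilon norm_le_zero_iff right_minus_eq)
qed

section \<open>Regulated functions\<close>

lemma AE_lebesgue_on_iff:
  fixes l r :: real
  shows "(AE x in lebesgue_on {l<..<r}. P x) \<longleftrightarrow> (AE x in lebesgue. x \<in> {l<..<r} \<longrightarrow> P x)"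
  by (subst AE_restrict_space_iff) auto

lemma eventually_inf_ae_filterI:
  assumes "eventually P F" "AE x in lebesgue. Q x" "\<And>x. P x \<Longrightarrow> Q x \<Longrightarrow> R x"
  shows "eventually R (inf F (ae_filter lebesgue))"
  using assms unfolding eventually_inf by blast

lemma eventually_ess_at_rightI:
  assumes "AE x in lebesgue_on {l<..<r}. P x" "l < r"
  shows "eventually P (ess_at_right l)"
  unfolding ess_at_right_def
  using eventually_at_right_real[OF assms(2)] assms(1)[unfolded AE_lebesgue_on_iff]
  by (rule eventually_inf_ae_filterI) auto

lemma eventually_ess_at_leftI:
  assumes "AE x in lebesgue_on {l<..<r}. P x" "l < r"
  shows "eventually P (ess_at_left r)"
  unfolding ess_at_left_def
  using eventually_at_left_real[OF assms(2)] assms(1)[unfolded AE_lebesgue_on_iff]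
  by (rule eventually_inf_ae_filterI) auto

text \<open>Nonempty open intervals are not null; this makes the essential one-sided filters proper,
  so that limits along them are unique.\<close>

lemma not_AE_notin_interval:
  fixes l r :: real
  assumes "l < r"
  shows "\<not> (AE x in lebesgue. x \<notin> {l<..<r})"
proof
  assume "AE x in lebesgue. x \<notin> {l<..<r}"
  then have "{l<..<r} \<in> null_sets lebesgue"
    by (subst (asm) AE_iff_null_sets[symmetric]) auto
  then have "negligible {l<..<r}"
    by (simp add: negligible_iff_null_sets)
  then show False
    using assms open_not_negligible[of "{l<..<r}"] by auto
qed

lemma ess_at_right_neq_bot [simp]: "ess_at_right a \<noteq> bot"
proof
  assume "ess_at_right a = bot"
  then have "eventually (\<lambda>x. False) (ess_at_right a)"
    by simp
  then obtain P Q where P: "eventually P (at_right a)" "AE x in lebesgue. Q x" and PQ: "\<And>x. \<not> (P x \<and> Q x)"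
    unfolding ess_at_right_def eventually_inf by blast
  obtain b where b: "b > a" "\<And>x. a < x \<Longrightarrow> x < b \<Longrightarrow> P x"
    using P(1) unfolding eventually_at_right_field by blast
  have "AE x in lebesgue. x \<notin> {a<..<b}"
    using P(2) by eventually_elim (use b PQ in auto)
  with not_AE_notin_interval b show False
    by blast
qed

lemma ess_at_left_neq_bot [simp]: "ess_at_left a \<noteq> bot"
proof
  assume "ess_at_left a = bot"
  then have "eventually (\<lambda>x. False) (ess_at_left a)"
    by simp
  then obtain P Q where P: "eventually P (at_left a)" "AE x in lebesgue. Q x" and PQ: "\<And>x. \<not> (P x \<and> Q x)"
    unfolding ess_at_left_def eventually_inf by blast
  obtain b where b: "b < a" "\<And>x. b < x \<Longrightarrow> x < a \<Longrightarrow> P x"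
    using P(1) unfolding eventually_at_left_field by blast
  have "AE x in lebesgue. x \<notin> {b<..<a}"
    using P(2) by eventually_elim (use b PQ in auto)
  with not_AE_notin_interval b show False
    by blast
qed

section \<open>Approximation of regulated functions by step functions\<close>

text \<open>Induction over the jumps with the interval left arbitrary: a jump inside the interval
  cuts it into two pieces, to each of which the hypothesis for the remaining jumps applies, and
  contributes one further value.\<close>

lemma bounded_if_constant_off_finite:
  fixes s :: "real \<Rightarrow> complex"
  assumes "finite F" "\<And>I. connected I \<Longrightarrow> I \<subseteq> {l<..<r} - F \<Longrightarrow> s constant_on I"
  shows "bounded (s ` {l<..<r})"
  using assms
proof (induction F arbitrary: l r rule: finite_induct)
  case empty
  then have "s constant_on {l<..<r}"
    by (metis Diff_empty connected_Ioo order_refl)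
  then have "s ` {l<..<r} \<subseteq> {s ((l + r) / 2)}"
    unfolding constant_on_def by fastforce
  then show ?case
    by (rule bounded_subset[rotated]) simp
next
  case (insert c F)
  show ?case
  proof (cases "c \<in> {l<..<r}")
    case False
    then show ?thesis
      by (intro insert.IH insert.prems) auto
  next
    case True
    then have "bounded (s ` {l<..<c})" "bounded (s ` {c<..<r})"
      by (auto intro!: insert.IH insert.prems)
    moreover have "{l<..<r} = {l<..<c} \<union> {c<..<r} \<union> {c}"
      using True by auto
    ultimately show ?thesis
      by (simp add: image_Un)
  qed
qed

text \<open>Replaces components by arbitrary connected subsets, so that constancy can be used on
  small intervals chosen later, and merges countably many exceptional sets into one that serves all
  \<open>n\<close>.\<close>

lemma Reg_approx:
  assumes "f \<in> Reg X"
  obtains s F where "\<And>n. finite (F n)"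
    "\<And>n I. connected I \<Longrightarrow> I \<subseteq> X - F n \<Longrightarrow> s n constant_on I"
    "AE x in lebesgue_on X. \<forall>n. norm (f x - s n x) \<le> inverse (Suc n)"
proof -
  have "\<exists>s. s \<in> Step X \<and> (AE x in lebesgue_on X. norm (f x - s x) \<le> inverse (Suc n))" for n
    using assms unfolding Reg_def
    by (auto simp del: of_nat_Suc dest!: spec[of _ "inverse (real (Suc n))"])
  then obtain s where s: "\<And>n. s n \<in> Step X"
    "\<And>n. AE x in lebesgue_on X. norm (f x - s n x) \<le> inverse (Suc n)"
    by metis
  from s(1) obtain F where F: "\<And>n. finite (F n)" "\<And>n I. I \<in> components (X - F n) \<Longrightarrow> s n constant_on I"
    unfolding Step_def by simp metis
  show ?thesis
  proof (rule that)
    show "s n constant_on I" if "connected I" "I \<subseteq> X - F n" for n I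
    proof (cases "I = {}")
      case False
      with that obtain C where "C \<in> components (X - F n)" "I \<subseteq> C"
        using exists_component_superset[of I "X - F n"] by auto
      with F(2)[of C n] show ?thesis
        unfolding constant_on_def by blast
    qed (auto simp: constant_on_def)
  qed (use F s in \<open>auto simp: AE_all_countable\<close>)
qed

lemma Reg_ess_bounded:
  assumes "f \<in> Reg {l<..<r}"
  shows "\<exists>M. AE x in lebesgue_on {l<..<r}. norm (f x) \<le> M"
proof -
  obtain s F where F: "\<And>n. finite (F n)"
    "\<And>n I. connected I \<Longrightarrow> I \<subseteq> {l<..<r} - F n \<Longrightarrow> s n constant_on I"
    and ae: "AE x in lebesgue_on {l<..<r}. \<forall>n. norm (f x - s n x) \<le> inverse (Suc n)"
    by (rule Reg_approx[OF assms]) (rule that; assumption)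
  have "bounded (s 0 ` {l<..<r})"
    by (rule bounded_if_constant_off_finite[OF F(1)[of 0] F(2)])
  then obtain M where M: "\<And>x. x \<in> {l<..<r} \<Longrightarrow> norm (s 0 x) \<le> M"
    unfolding bounded_iff by blast
  have "AE x in lebesgue_on {l<..<r}. norm (f x) \<le> M + 1"
    using ae AE_space
  proof eventually_elim
    case (elim x)
    then have "norm (f x - s 0 x) \<le> 1" "norm (s 0 x) \<le> M"
      using M by (auto dest: spec[of _ 0])
    then show ?case
      using norm_triangle_sub[of "f x" "s 0 x"] by linarith
  qed
  then show ?thesis ..
qed

text \<open>The hypothesis on \<open>G\<close> says that every step function is eventually constant
  along \<open>G\<close>; this covers both ends of the interval at once. The constants of the
  approximating step functions form a Cauchy sequence, and its limit is the limit of
  \<open>f\<close>.\<close>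

lemma Reg_ess_limit:
  assumes f: "f \<in> Reg {l<..<r}"
    and G: "\<And>F. finite F \<Longrightarrow> \<exists>I. connected I \<and> I \<subseteq> {l<..<r} - F \<and> eventually (\<lambda>x. x \<in> I) G"
    and bot: "inf G (ae_filter lebesgue) \<noteq> bot"
  shows "\<exists>c. (f \<longlongrightarrow> c) (inf G (ae_filter lebesgue))"
proof -
  define H where "H = inf G (ae_filter lebesgue)"
  obtain s F where F: "\<And>n. finite (F n)"
    "\<And>n I. connected I \<Longrightarrow> I \<subseteq> {l<..<r} - F n \<Longrightarrow> s n constant_on I"
    and ae: "AE x in lebesgue_on {l<..<r}. \<forall>n. norm (f x - s n x) \<le> inverse (Suc n)"
    by (rule Reg_approx[OF f]) (rule that; assumption)
  have "\<exists>c. eventually (\<lambda>x. norm (f x - c) \<le> inverse (Suc n)) H" for n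
  proof -
    obtain I where I: "connected I" "I \<subseteq> {l<..<r} - F n" "eventually (\<lambda>x. x \<in> I) G"
      using G F by blast
    with F obtain c where c: "\<And>x. x \<in> I \<Longrightarrow> s n x = c"
      unfolding constant_on_def by meson
    have "eventually (\<lambda>x. norm (f x - c) \<le> inverse (Suc n)) H"
      unfolding H_def using I(3) ae[unfolded AE_lebesgue_on_iff]
      by (rule eventually_inf_ae_filterI) (use I c in force)
    then show ?thesis ..
  qed
  then obtain c where c: "\<And>n. eventually (\<lambda>x. norm (f x - c n) \<le> inverse (Suc n)) H"
    by metis
  have cc: "norm (c m - c n) \<le> inverse (Suc m) + inverse (Suc n)" for m n
  proof -
    \<comment> \<open>Properness of the filter supplies a common point at which both estimates
      hold.\<close>
    have "\<exists>x. norm (f x - c m) \<le> inverse (Suc m) \<and> norm (f x - c n) \<le> inverse (Suc n)"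
      using eventually_happens'[OF bot[folded H_def] eventually_conj[OF c[of m] c[of n]]] .
    then obtain x where "norm (f x - c m) \<le> inverse (Suc m)" "norm (f x - c n) \<le> inverse (Suc n)"
      by blast
    then show ?thesis
      using norm_triangle_ineq4[of "f x - c n" "f x - c m"] by simp
  qed
  have "Cauchy c"
  proof (rule metric_CauchyI)
    fix e :: real assume "e > 0"
    then obtain N where N: "inverse (real (Suc N)) < e / 2"
      using reals_Archimedean[of "e/2"] by auto
    have "dist (c m) (c n) < e" if "m \<ge> N" "n \<ge> N" for m n
    proof -
      have "inverse (real (Suc m)) \<le> inverse (real (Suc N))" "inverse (real (Suc n)) \<le> inverse (real (Suc N))"
        using that by (auto intro!: le_imp_inverse_le)
      with cc[of m n] N show ?thesis
        unfolding dist_norm by linarith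
    qed
    then show "\<exists>M. \<forall>m\<ge>M. \<forall>n\<ge>M. dist (c m) (c n) < e"
      by blast
  qed
  then obtain L where L: "c \<longlonglongrightarrow> L"
    using Cauchy_convergent convergent_def by blast
  have "(f \<longlongrightarrow> L) H"
  proof (rule tendstoI)
    fix e :: real assume "e > 0"
    then obtain N where N: "inverse (real (Suc N)) < e / 2"
      using reals_Archimedean[of "e/2"] by auto
    have "eventually (\<lambda>n. dist (c n) L < e / 2 \<and> n \<ge> N) sequentially"
      using L \<open>e > 0\<close> by (intro eventually_conj tendstoD eventually_ge_at_top) auto
    then obtain n where n: "dist (c n) L < e / 2" "n \<ge> N"
      by (auto simp: eventually_sequentially)
    then have "inverse (real (Suc n)) \<le> inverse (real (Suc N))"
      by (auto intro!: le_imp_inverse_le)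
    with N have n': "inverse (real (Suc n)) < e / 2"
      by linarith
    show "eventually (\<lambda>x. dist (f x) L < e) H"
      using c[of n]
    proof eventually_elim
      case (elim x)
      have "dist (f x) L \<le> norm (f x - c n) + dist (c n) L"
        using dist_triangle[of "f x" L "c n"] by (simp add: dist_norm)
      with elim n n' show ?case
        by linarith
    qed
  qed
  then show ?thesis
    unfolding H_def ..
qed

lemma eventually_at_notin_finite:
  fixes a :: real
  assumes "finite F"
  shows "eventually (\<lambda>x. x \<notin> F) (at a)"
proof -
  have "eventually (\<lambda>x. x \<in> - (F - {a})) (nhds a)"
    using assms by (intro eventually_nhds_in_open open_Compl finite_imp_closed) auto
  then show ?thesis
    unfolding eventually_at_filter by eventually_elim auto
qed

lemma Reg_ess_limit_right:
  assumes "f \<in> Reg {l<..<r}" "l < r"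
  shows "\<exists>c. (f \<longlongrightarrow> c) (ess_at_right l)"
  unfolding ess_at_right_def
proof (rule Reg_ess_limit[OF assms(1)])
  fix F :: "real set" assume "finite F"
  then have "eventually (\<lambda>x. x \<notin> F) (at_right l)"
    using eventually_at_notin_finite filter_leD[OF at_le[OF subset_UNIV]] by blast
  then obtain b where "b > l" "\<And>x. l < x \<Longrightarrow> x < b \<Longrightarrow> x \<notin> F"
    unfolding eventually_at_right_field by blast
  then show "\<exists>I. connected I \<and> I \<subseteq> {l<..<r} - F \<and> eventually (\<lambda>x. x \<in> I) (at_right l)"
    using assms eventually_at_right_real[of l "min r b"]
    by (intro exI[of _ "{l<..<min r b}"]) auto
qed (use ess_at_right_neq_bot ess_at_right_def in auto)

lemma Reg_ess_limit_left:
  assumes "f \<in> Reg {l<..<r}" "l < r"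
  shows "\<exists>c. (f \<longlongrightarrow> c) (ess_at_left r)"
  unfolding ess_at_left_def
proof (rule Reg_ess_limit[OF assms(1)])
  fix F :: "real set" assume "finite F"
  then have "eventually (\<lambda>x. x \<notin> F) (at_left r)"
    using eventually_at_notin_finite filter_leD[OF at_le[OF subset_UNIV]] by blast
  then obtain b where "b < r" "\<And>x. b < x \<Longrightarrow> x < r \<Longrightarrow> x \<notin> F"
    unfolding eventually_at_left_field by blast
  then show "\<exists>I. connected I \<and> I \<subseteq> {l<..<r} - F \<and> eventually (\<lambda>x. x \<in> I) (at_left r)"
    using assms eventually_at_left_real[of "max l b" r]
    by (intro exI[of _ "{max l b<..<r}"]) auto
qed (use ess_at_left_neq_bot ess_at_left_def in auto)

text \<open>The jumps of all approximating step functions form a countable set. Off this set and off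
  the exceptional null set, each \<open>s n\<close> is constant near \<open>x\<close>, so
  \<open>f\<close> differs from \<open>f x\<close> by at most twice \<open>inverse (Suc n)\<close>
  at almost all nearby points.\<close>

lemma Reg_ess_continuous:
  assumes f: "f \<in> Reg {l<..<r}"
  shows "AE x in lebesgue_on {l<..<r}. (f \<longlongrightarrow> f x) (inf (at x) (ae_filter lebesgue))"
proof -
  obtain s F where F: "\<And>n. finite (F n)"
    "\<And>n I. connected I \<Longrightarrow> I \<subseteq> {l<..<r} - F n \<Longrightarrow> s n constant_on I"
    and ae: "AE x in lebesgue_on {l<..<r}. \<forall>n. norm (f x - s n x) \<le> inverse (Suc n)"
    by (rule Reg_approx[OF f]) (rule that; assumption)
  have "countable (\<Union>n. F n)"
    using F by (auto intro: countable_finite)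
  then have "(\<Union>n. F n) \<in> null_sets lebesgue"
    by (simp add: countable_imp_null_set_lborel null_sets_completionI)
  then have "AE x in lebesgue. x \<notin> (\<Union>n. F n)"
    by (rule AE_not_in)
  then show ?thesis
    using ae unfolding AE_lebesgue_on_iff
  proof eventually_elim
    case (elim x)
    show ?case
    proof (intro impI tendstoI)
      fix e :: real assume x: "x \<in> {l<..<r}" and "e > 0"
      then obtain n where n: "inverse (real (Suc n)) < e / 2"
        using reals_Archimedean[of "e/2"] by auto
      have "open ({l<..<r} - F n)" "x \<in> {l<..<r} - F n"
        using x elim by (auto intro!: open_Diff finite_imp_closed F)
      then obtain d where d: "d > 0" "ball x d \<subseteq> {l<..<r} - F n"
        by (meson openE)
      then obtain c where c: "\<And>y. y \<in> ball x d \<Longrightarrow> s n y = c"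
        using F(2)[of "ball x d" n] unfolding constant_on_def by (auto simp: convex_connected)
      have "eventually (\<lambda>y. y \<in> ball x d) (at x)"
        using d by (intro eventually_at_in_open') auto
      then show "\<forall>\<^sub>F y in inf (at x) (ae_filter lebesgue). dist (f y) (f x) < e"
        using ae[unfolded AE_lebesgue_on_iff]
      proof (rule eventually_inf_ae_filterI)
        fix y assume y: "y \<in> ball x d" "y \<in> {l<..<r} \<longrightarrow> (\<forall>n. norm (f y - s n y) \<le> inverse (Suc n))"
        then have "norm (f y - c) \<le> inverse (Suc n)"
          using d c by (metis Diff_iff subsetD)
        moreover have "norm (f x - c) \<le> inverse (Suc n)"
          using x elim c[of x] d by (metis centre_in_ball)
        moreover have "dist (f y) (f x) \<le> norm (f y - c) + norm (f x - c)"
          using dist_triangle2[of "f y" "f x" c] by (simp add: dist_norm)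
        ultimately show "dist (f y) (f x) < e"
          using n by linarith
      qed
    qed
  qed
qed

lemma Reg_plusE:
  assumes "\<zeta> \<in> Reg_plus {l<..<r}" "l < r"
  obtains m M z0 z1 where "m > 0" "\<And>x. x \<in> {l<..<r} \<Longrightarrow> m < \<zeta> x" "AE x in lebesgue_on {l<..<r}. \<zeta> x \<le> M"
    "\<zeta> \<in> borel_measurable (lebesgue_on {l<..<r})"
    "z0 > 0" "(\<zeta> \<longlongrightarrow> z0) (ess_at_right l)" "z1 > 0" "(\<zeta> \<longlongrightarrow> z1) (ess_at_left r)"
    "AE x in lebesgue_on {l<..<r}. (\<zeta> \<longlongrightarrow> \<zeta> x) (inf (at x) (ae_filter lebesgue))"
proof -
  define f where "f = (\<lambda>x. complex_of_real (\<zeta> x))"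
  have Re: "\<zeta> = (\<lambda>x. Re (f x))"
    by (simp add: f_def)
  from assms obtain m where f: "f \<in> Reg {l<..<r}" and m: "m > 0" "\<And>x. x \<in> {l<..<r} \<Longrightarrow> m < \<zeta> x"
    unfolding Reg_plus_def f_def by blast
  obtain M where M: "AE x in lebesgue_on {l<..<r}. norm (f x) \<le> M"
    using Reg_ess_bounded f by blast
  obtain c0 c1 where c: "(f \<longlongrightarrow> c0) (ess_at_right l)" "(f \<longlongrightarrow> c1) (ess_at_left r)"
    using Reg_ess_limit_left[OF f assms(2)] Reg_ess_limit_right[OF f assms(2)] by blast
  \<comment> \<open>The uniform lower bound survives in the limit, so the end values of
    \<open>\<zeta>\<close> are positive and can be divided by.\<close>
  have ml: "AE x in lebesgue_on {l<..<r}. m \<le> Re (f x)"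
    using m by (intro AE_I2) (auto simp: f_def less_imp_le)
  have c0: "m \<le> Re c0"
    by (rule tendsto_lowerbound[OF tendsto_Re[OF c(1)] eventually_ess_at_rightI[OF ml assms(2)]]) simp
  have c1: "m \<le> Re c1"
    by (rule tendsto_lowerbound[OF tendsto_Re[OF c(2)] eventually_ess_at_leftI[OF ml assms(2)]]) simp
  show ?thesis
  proof (rule that[of m M "Re c0" "Re c1"])
    show "AE x in lebesgue_on {l<..<r}. \<zeta> x \<le> M"
      using M by eventually_elim (auto simp: f_def)
    show "\<zeta> \<in> borel_measurable (lebesgue_on {l<..<r})"
      using f unfolding Re Reg_def by auto
    show "AE x in lebesgue_on {l<..<r}. (\<zeta> \<longlongrightarrow> \<zeta> x) (inf (at x) (ae_filter lebesgue))"
      using Reg_ess_continuous[OF f] by eventually_elim (auto simp: Re intro: tendsto_Re)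
  qed (use m c c0 c1 in \<open>auto simp: Re intro: tendsto_Re\<close>)
qed

section \<open>The integral equation\<close>

lemma integral_exp_weight:
  fixes B :: real
  assumes "B > 0" "x \<le> b"
  shows "((\<lambda>t. B * exp (2 * B * (b - t))) has_integral (exp (2 * B * (b - x)) - 1) / 2) {x..b}"
proof -
  have "((\<lambda>t. B * exp (2 * B * (b - t))) has_integral
      (- exp (2 * B * (b - b)) / 2 - - exp (2 * B * (b - x)) / 2)) {x..b}"
    using assms by (intro fundamental_theorem_of_calculus)
      (auto intro!: derivative_eq_intros simp flip: has_real_derivative_iff_has_vector_derivative)
  then show ?thesis
    by (simp add: diff_divide_distrib)
qed

text \<open>Picard iteration converges at once on all of \<open>{a..b}\<close> with respect to the weight
  \<open>exp (2 * B * (b - t))\<close>, for which the integral operator has Lipschitz constant \<open>1/2\<close>.\<close>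

lemma integral_equation_solution:
  fixes G :: "real \<Rightarrow> 'a::euclidean_space \<Rightarrow> 'a"
  assumes ab: "a \<le> b" and B: "B > 0"
    and lip: "\<And>t y z. t \<in> {a..b} \<Longrightarrow> norm (G t y - G t z) \<le> B * norm (y - z)"
    and int: "\<And>y. continuous_on {a..b} y \<Longrightarrow> (\<lambda>t. G t (y t)) integrable_on {a..b}"
  obtains y where "continuous_on {a..b} y"
    "\<And>x. x \<in> {a..b} \<Longrightarrow> y x = c - integral {x..b} (\<lambda>t. G t (y t))"
proof -
  \<comment> \<open>The integral runs from \<open>x\<close> to the right end because
    \<open>c\<close> is the value prescribed at \<open>b\<close>.\<close>
  define T where "T y x = c - integral {x..b} (\<lambda>t. G t (y t))" for y x
  have T_cont: "continuous_on {a..b} (T y)" if "continuous_on {a..b} y" for y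
    unfolding T_def by (intro continuous_intros indefinite_integral_continuous_1' int that)
  have T_contr: "norm (T y x - T z x) \<le> K / 2 * exp (2 * B * (b - x))"
    if y: "continuous_on {a..b} y" and z: "continuous_on {a..b} z" and x: "x \<in> {a..b}" and "K \<ge> 0"
      and K: "\<And>t. t \<in> {a..b} \<Longrightarrow> norm (y t - z t) \<le> K * exp (2 * B * (b - t))" for y z x K
  proof -
    have i: "(\<lambda>t. G t (w t)) integrable_on {x..b}" if "continuous_on {a..b} w" for w
      using int[OF that] x by (auto intro: integrable_subinterval_real)
    have e: "((\<lambda>t. K * (B * exp (2 * B * (b - t)))) has_integral K * ((exp (2 * B * (b - x)) - 1) / 2)) {x..b}"
      using B x by (intro has_integral_mult_right integral_exp_weight) auto
    have "T y x - T z x = - integral {x..b} (\<lambda>t. G t (y t) - G t (z t))"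
      unfolding T_def using i[OF y] i[OF z] by (subst integral_diff) auto
    then have "norm (T y x - T z x) = norm (integral {x..b} (\<lambda>t. G t (y t) - G t (z t)))"
      by simp
    also have "\<dots> \<le> integral {x..b} (\<lambda>t. K * (B * exp (2 * B * (b - t))))"
    proof (rule integral_norm_bound_integral)
      fix t assume "t \<in> {x..b}"
      then have t: "t \<in> {a..b}"
        using x by auto
      have "norm (G t (y t) - G t (z t)) \<le> B * norm (y t - z t)"
        by (rule lip[OF t])
      also have "\<dots> \<le> B * (K * exp (2 * B * (b - t)))"
        using K[OF t] B by (intro mult_left_mono) auto
      finally show "norm (G t (y t) - G t (z t)) \<le> K * (B * exp (2 * B * (b - t)))"
        by (simp add: mult_ac)
    qed (use i[OF y] i[OF z] e in \<open>auto intro: integrable_diff\<close>)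
    also have "\<dots> = K * ((exp (2 * B * (b - x)) - 1) / 2)"
      using e by (rule integral_unique)
    also have "\<dots> \<le> K / 2 * exp (2 * B * (b - x))"
      using \<open>K \<ge> 0\<close> by (simp add: algebra_simps)
    finally show ?thesis .
  qed
  define Y where "Y n = (T ^^ n) (\<lambda>_. c)" for n
  have Y_Suc: "Y (Suc n) = T (Y n)" for n
    by (simp add: Y_def)
  have Y_cont: "continuous_on {a..b} (Y n)" for n
    by (induction n) (auto simp: Y_Suc T_cont, simp add: Y_def)
  have "bounded ((\<lambda>x. Y (Suc 0) x - Y 0 x) ` {a..b})"
    by (intro compact_imp_bounded compact_continuous_image continuous_intros Y_cont) auto
  then obtain K where K: "K > 0" "\<And>x. x \<in> {a..b} \<Longrightarrow> norm (Y (Suc 0) x - Y 0 x) \<le> K"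
    unfolding bounded_pos by auto
  have exp1: "1 \<le> exp (2 * B * (b - x))" if "x \<in> {a..b}" for x
    using that B by auto
  have Y_diff: "norm (Y (Suc n) x - Y n x) \<le> K / 2 ^ n * exp (2 * B * (b - x))" if "x \<in> {a..b}" for n x
    using that
  proof (induction n arbitrary: x)
    case 0
    have "K * 1 \<le> K * exp (2 * B * (b - x))"
      using K exp1[OF 0] by (intro mult_left_mono) auto
    with K(2)[OF 0] show ?case
      by simp
  next
    case (Suc n)
    have "norm (T (Y (Suc n)) x - T (Y n) x) \<le> K / 2 ^ n / 2 * exp (2 * B * (b - x))"
      using Suc K by (intro T_contr Y_cont) auto
    then show ?case
      by (simp add: Y_Suc field_simps)
  qed
  define E where "E = exp (2 * B * (b - a))"
  have E: "exp (2 * B * (b - x)) \<le> E" if "x \<in> {a..b}" for x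
    using that B by (auto simp: E_def)
  have "uniform_limit {a..b} (\<lambda>n x. \<Sum>i<n. Y (Suc i) x - Y i x) (\<lambda>x. \<Sum>i. Y (Suc i) x - Y i x) sequentially"
  proof (rule Weierstrass_m_test)
    show "norm (Y (Suc n) x - Y n x) \<le> K * E * (1 / 2) ^ n" if "x \<in> {a..b}" for n x
    proof -
      have "K / 2 ^ n * exp (2 * B * (b - x)) \<le> K / 2 ^ n * E"
        using K E[OF that] by (intro mult_left_mono) auto
      with Y_diff[OF that, of n] show ?thesis
        by (simp add: field_simps)
    qed
    show "summable (\<lambda>n. K * E * (1 / 2) ^ n)"
      by (intro summable_mult summable_geometric) auto
  qed
  moreover have "(\<Sum>i<n. Y (Suc i) x - Y i x) = Y n x - c" for n x
    by (subst sum_lessThan_telescope) (simp add: Y_def)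
  moreover define y where "y x = (\<Sum>i. Y (Suc i) x - Y i x) + c" for x
  ultimately have "uniform_limit {a..b} (\<lambda>n x. Y n x - c) (\<lambda>x. y x - c) sequentially"
    by simp
  then have lim: "uniform_limit {a..b} Y y sequentially"
    unfolding uniform_limit_iff by (simp add: dist_norm)
  have y_cont: "continuous_on {a..b} y"
    by (rule uniform_limit_theorem[OF _ lim]) (simp_all add: Y_cont)
  have "y x = T y x" if x: "x \<in> {a..b}" for x
  proof -
    have "norm (T y x - y x) \<le> 0 + e" if "e > 0" for e
    proof -
      \<comment> \<open>One \<open>d\<close> pays for the distance from the next iterate to
        \<open>y\<close>, and \<open>d * E\<close> for applying \<open>T\<close> to \<open>y\<close>
        and to the iterate; together they give \<open>e\<close>.\<close>
      define d where "d = e / (1 + E)"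
      have "E > 0"
        by (simp add: E_def)
      then have "d > 0" "d * (1 + E) = e"
        using that by (auto simp: d_def)
      then have d: "d > 0" "d + d * E = e"
        by (auto simp: distrib_left)
      have "eventually (\<lambda>n. \<forall>t\<in>{a..b}. dist (Y n t) (y t) < d) sequentially"
        using lim d unfolding uniform_limit_iff by auto
      then obtain N where N: "\<And>n t. n \<ge> N \<Longrightarrow> t \<in> {a..b} \<Longrightarrow> norm (Y n t - y t) < d"
        unfolding eventually_sequentially dist_norm by blast
      have "norm (T y x - T (Y N) x) \<le> d / 2 * exp (2 * B * (b - x))"
      proof (rule T_contr[OF y_cont Y_cont x])
        fix t assume t: "t \<in> {a..b}"
        have "norm (y t - Y N t) \<le> d * 1"
          using N[of N t] t by (simp add: norm_minus_commute)
        also have "\<dots> \<le> d * exp (2 * B * (b - t))"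
          using exp1[OF t] d by (intro mult_left_mono) auto
        finally show "norm (y t - Y N t) \<le> d * exp (2 * B * (b - t))" .
      qed (use d in auto)
      also have "\<dots> \<le> d * E"
        using E[OF x] d by (intro mult_mono) auto
      finally have "norm (T y x - Y (Suc N) x) \<le> d * E"
        by (simp add: Y_Suc)
      moreover have "norm (Y (Suc N) x - y x) < d"
        using N x by auto
      ultimately show ?thesis
        using d norm_triangle_ineq[of "T y x - Y (Suc N) x" "Y (Suc N) x - y x"] by simp
    qed
    then show ?thesis
      by (metis field_le_epsilon norm_le_zero_iff right_minus_eq)
  qed
  with y_cont show ?thesis
    unfolding T_def by (intro that)
qed

text \<open>Continuity at \<open>x\<close> modulo null sets becomes ordinary continuity once
  \<open>f\<close> is given the value \<open>f x\<close> on a null set. A single such set works for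
  all tolerances, since countably many suffice; the integrals do not change, and the classical
  fundamental theorem applies. The minus sign comes from \<open>v\<close> being the lower
  limit.\<close>

lemma integral_has_vector_derivative_ess_continuous:
  fixes f :: "real \<Rightarrow> 'a::euclidean_space"
  assumes f: "f integrable_on {a..b}" and x: "a < x" "x < b"
    and lim: "(f \<longlongrightarrow> f x) (inf (at x) (ae_filter lebesgue))"
  shows "((\<lambda>v. integral {v..b} f) has_vector_derivative - f x) (at x)"
proof -
  have "\<exists>P Q. eventually P (at x) \<and> (AE t in lebesgue. Q t) \<and>
      (\<forall>t. P t \<and> Q t \<longrightarrow> dist (f t) (f x) < inverse (Suc n))" for n
    using tendstoD[OF lim, of "inverse (Suc n)"] unfolding eventually_inf by auto
  then obtain P Q where P: "\<And>n. eventually (P n) (at x)" and Q: "\<And>n. AE t in lebesgue. Q n t"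
    and PQ: "\<And>n t. P n t \<Longrightarrow> Q n t \<Longrightarrow> dist (f t) (f x) < inverse (Suc n)"
    by metis
  have "AE t in lebesgue. \<forall>n. Q n t"
    using Q by (simp add: AE_all_countable)
  then obtain N where N: "N \<in> null_sets lebesgue" "{t. \<not> (\<forall>n. Q n t)} \<subseteq> N"
    unfolding eventually_ae_filter by auto
  then have negl: "negligible N"
    by (simp add: negligible_iff_null_sets)
  define h where "h t = (if t \<in> N then f x else f t)" for t
  have int_h: "h integrable_on {a..b}"
    using f negl by (rule integrable_spike) (auto simp: h_def)
  have eq: "integral {c..d} h = integral {c..d} f" for c d
    using negl by (rule integral_spike) (auto simp: h_def)
  have "(h \<longlongrightarrow> f x) (at x)"
  proof (rule tendstoI)
    fix e :: real assume "e > 0"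
    then obtain n where n: "inverse (real (Suc n)) < e"
      using reals_Archimedean by blast
    show "eventually (\<lambda>t. dist (h t) (f x) < e) (at x)"
      using P[of n]
    proof eventually_elim
      case (elim t)
      show ?case
      proof (cases "t \<in> N")
        case True
        with \<open>e > 0\<close> show ?thesis
          by (simp add: h_def)
      next
        case False
        with N have "Q n t"
          by auto
        with PQ[OF elim] n False show ?thesis
          by (auto simp: h_def)
      qed
    qed
  qed
  moreover have hx: "h x = f x"
    by (simp add: h_def)
  ultimately have "continuous (at x within {a..b}) h"
    by (simp add: continuous_at_imp_continuous_at_within continuous_at)
  then have "((\<lambda>v. integral {a..v} h) has_vector_derivative h x) (at x within {a..b})"
    using integral_has_vector_derivative_continuous_at[OF int_h, of x "{}"] x by auto
  moreover have "at x within {a..b} = at x"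
    using x by (intro at_within_interior) (auto simp: interior_atLeastAtMost_real)
  ultimately have "((\<lambda>v. integral {a..b} f - integral {a..v} f) has_vector_derivative 0 - f x) (at x)"
    unfolding eq hx by (intro has_vector_derivative_diff has_vector_derivative_const) simp
  then have "((\<lambda>v. integral {v..b} f) has_vector_derivative 0 - f x) (at x)"
  proof (rule has_vector_derivative_transform_within_open[of _ _ _ "{a<..<b}"])
    fix v assume "v \<in> {a<..<b}"
    then show "integral {a..b} f - integral {a..v} f = integral {v..b} f"
      using Henstock_Kurzweil_Integration.integral_combine[OF _ _ f, of v] by (auto simp: algebra_simps)
  qed (use x in auto)
  then show ?thesis
    by simp
qed

lemma lipschitz_imp_absolutely_continuous_on:
  assumes "\<And>x y. x \<in> X \<Longrightarrow> y \<in> X \<Longrightarrow> x \<le> y \<Longrightarrow> norm (f y - f x) \<le> L * (y - x)"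
  shows "absolutely_continuous_on X f"
  unfolding absolutely_continuous_on_def
proof (intro allI impI)
  fix e :: real assume "e > 0"
  show "\<exists>d>0. \<forall>P. finite P \<and> (\<forall>(a, b)\<in>P. a \<le> b \<and> {a..b} \<subseteq> X) \<and>
       disjoint_family_on (\<lambda>(a, b). {a<..<b}) P \<and> (\<Sum>(a, b)\<in>P. b - a) < d \<longrightarrow>
       (\<Sum>(a, b)\<in>P. norm (f b - f a)) < e"
  proof (rule exI[of _ "e / (\<bar>L\<bar> + 1)"], intro conjI allI impI)
    show "e / (\<bar>L\<bar> + 1) > 0"
      using \<open>e > 0\<close> by simp
    fix P :: "(real \<times> real) set"
    assume "finite P \<and> (\<forall>(a, b)\<in>P. a \<le> b \<and> {a..b} \<subseteq> X) \<and>
       disjoint_family_on (\<lambda>(a, b). {a<..<b}) P \<and> (\<Sum>(a, b)\<in>P. b - a) < e / (\<bar>L\<bar> + 1)"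
    then have P: "\<forall>(a, b)\<in>P. a \<le> b \<and> {a..b} \<subseteq> X" "(\<Sum>(a, b)\<in>P. b - a) < e / (\<bar>L\<bar> + 1)"
      by auto
    have "(\<Sum>(a, b)\<in>P. norm (f b - f a)) \<le> (\<Sum>(a, b)\<in>P. (\<bar>L\<bar> + 1) * (b - a))"
    proof (intro sum_mono, clarify)
      fix a b assume "(a, b) \<in> P"
      with P have ab: "a \<le> b" "{a..b} \<subseteq> X"
        by auto
      then have "norm (f b - f a) \<le> L * (b - a)"
        by (intro assms) auto
      also have "\<dots> \<le> (\<bar>L\<bar> + 1) * (b - a)"
        using ab by (intro mult_right_mono) auto
      finally show "norm (f b - f a) \<le> (\<bar>L\<bar> + 1) * (b - a)" .
    qed
    also have "\<dots> = (\<bar>L\<bar> + 1) * (\<Sum>(a, b)\<in>P. b - a)"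
      by (simp add: sum_distrib_left split_def)
    also have "\<dots> < e"
      using P(2) by (simp add: field_simps)
    finally show "(\<Sum>(a, b)\<in>P. norm (f b - f a)) < e" .
  qed
qed

section \<open>Zero is exceptional\<close>

lemma L2_weighted_product_integrable:
  assumes "f \<in> L2 X" "g \<in> L2 X" "w \<in> borel_measurable (lebesgue_on X)"
    and w: "AE x in lebesgue_on X. \<bar>w x\<bar> \<le> M"
  shows "integrable (lebesgue_on X) (\<lambda>x. (w x *\<^sub>R f x) * cnj (g x))"
proof (rule Bochner_Integration.integrable_bound)
  have [measurable]: "f \<in> borel_measurable (lebesgue_on X)" "g \<in> borel_measurable (lebesgue_on X)"
    "w \<in> borel_measurable (lebesgue_on X)"
    using assms by (auto simp: L2_def)
  show "integrable (lebesgue_on X) (\<lambda>x. \<bar>M\<bar> * ((norm (f x))\<^sup>2 + (norm (g x))\<^sup>2))"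
    using assms by (intro integrable_mult_right integrable_add) (auto simp: L2_def)
  have [measurable]: "(\<lambda>x. cnj (g x)) \<in> borel_measurable (lebesgue_on X)"
    by (rule measurable_compose[of g _ borel])
      (auto intro!: borel_measurable_continuous_onI continuous_intros)
  show "(\<lambda>x. (w x *\<^sub>R f x) * cnj (g x)) \<in> borel_measurable (lebesgue_on X)"
    by measurable
  show "AE x in lebesgue_on X. norm ((w x *\<^sub>R f x) * cnj (g x)) \<le> norm (\<bar>M\<bar> * ((norm (f x))\<^sup>2 + (norm (g x))\<^sup>2))"
    using w
  proof eventually_elim
    case (elim x)
    \<comment> \<open>A product is bounded by the sum of the squares, which is an integrable
      majorant.\<close>
    have "norm (f x) * norm (g x) \<le> (norm (f x))\<^sup>2 + (norm (g x))\<^sup>2"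
      using sum_squares_bound[of "norm (f x)" "norm (g x)"]
        mult_nonneg_nonneg[OF norm_ge_zero[of "f x"] norm_ge_zero[of "g x"]]
      unfolding mult.assoc by linarith
    then have "\<bar>w x\<bar> * (norm (f x) * norm (g x)) \<le> \<bar>M\<bar> * ((norm (f x))\<^sup>2 + (norm (g x))\<^sup>2)"
      using elim by (intro mult_mono) auto
    then show ?case
      by (simp add: norm_mult mult.assoc abs_mult)
  qed
qed

lemma finite_measure_lebesgue_on_Ioo [simp]: "finite_measure (lebesgue_on {l<..<r::real})"
  by (intro finite_measure_lebesgue_on) auto

lemma const_in_L2: "(\<lambda>_. c) \<in> L2 {l<..<r}"
  unfolding L2_def by (auto intro: finite_measure.integrable_const)

lemma L2_diff:
  assumes "f \<in> L2 X" "g \<in> L2 X"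
  shows "(\<lambda>x. f x - g x) \<in> L2 X"
proof -
  have [measurable]: "f \<in> borel_measurable (lebesgue_on X)" "g \<in> borel_measurable (lebesgue_on X)"
    using assms by (auto simp: L2_def)
  have "integrable (lebesgue_on X) (\<lambda>x. (norm (f x - g x))\<^sup>2)"
  proof (rule Bochner_Integration.integrable_bound)
    show "integrable (lebesgue_on X) (\<lambda>x. 2 * ((norm (f x))\<^sup>2 + (norm (g x))\<^sup>2))"
      using assms by (intro integrable_mult_right integrable_add) (auto simp: L2_def)
    have "(norm (f x - g x))\<^sup>2 \<le> 2 * ((norm (f x))\<^sup>2 + (norm (g x))\<^sup>2)" for x
    proof -
      have "(norm (f x - g x))\<^sup>2 \<le> (norm (f x) + norm (g x))\<^sup>2"
        by (intro power_mono norm_triangle_ineq4) auto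
      also have "\<dots> \<le> 2 * ((norm (f x))\<^sup>2 + (norm (g x))\<^sup>2)"
        using sum_squares_bound[of "norm (f x)" "norm (g x)"] by (simp add: power2_sum)
      finally show ?thesis .
    qed
    then show "AE x in lebesgue_on X. norm ((norm (f x - g x))\<^sup>2) \<le> norm (2 * ((norm (f x))\<^sup>2 + (norm (g x))\<^sup>2))"
      by simp
  qed measurable
  then show ?thesis
    by (auto simp: L2_def)
qed

lemma test_function_has_derivative:
  assumes "test_function X \<eta>"
  shows "(\<eta> has_vector_derivative deriv \<eta> x) (at x)" "continuous_on S (deriv \<eta>)"
proof -
  have "(deriv ^^ 0) \<eta> differentiable (at x)"
    using assms unfolding test_function_def by blast
  then show "(\<eta> has_vector_derivative deriv \<eta> x) (at x)"
    by (metis DERIV_deriv_iff_real_differentiable funpow_0 has_real_derivative_iff_has_vector_derivative)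
  have "(deriv ^^ 1) \<eta> differentiable (at y)" for y
    using assms unfolding test_function_def by blast
  then show "continuous_on S (deriv \<eta>)"
    by (intro differentiable_imp_continuous_on) (auto simp: differentiable_on_def intro: differentiable_at_withinI)
qed

lemma test_function_deriv_integrable:
  assumes "test_function {l<..<r} \<eta>" "f \<in> L2 {l<..<r}"
  shows "integrable (lebesgue_on {l<..<r}) (\<lambda>x. deriv \<eta> x *\<^sub>R f x)"
proof -
  note cont = test_function_has_derivative(2)[OF assms(1)]
  have "bounded (deriv \<eta> ` {l..r})"
    by (intro compact_imp_bounded compact_continuous_image cont) auto
  then obtain B where "\<forall>x\<in>{l..r}. \<bar>deriv \<eta> x\<bar> \<le> B"
    unfolding bounded_iff by auto
  then have B: "AE x in lebesgue_on {l<..<r}. \<bar>deriv \<eta> x\<bar> \<le> B"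
    by (intro AE_I2) auto
  have "deriv \<eta> \<in> borel_measurable (lebesgue_on {l<..<r})"
    by (intro continuous_imp_measurable_on_sets_lebesgue cont) auto
  \<comment> \<open>Here the bounded function \<open>deriv \<eta>\<close> plays the role of the
    weight, and the second factor is the constant 1.\<close>
  from L2_weighted_product_integrable[OF assms(2) const_in_L2[of 1] this B] show ?thesis
    by simp
qed

lemma weak_deriv_const:
  assumes "l < r"
  shows "weak_deriv {l<..<r} (\<lambda>_. c) (\<lambda>_. 0)"
  unfolding weak_deriv_def
proof (intro allI impI)
  fix \<eta> assume \<eta>: "test_function {l<..<r} \<eta>"
  have "closure {x. \<eta> x \<noteq> 0} \<subseteq> {l<..<r}"
    using \<eta> by (simp add: test_function_def)
  then have "{x. \<eta> x \<noteq> 0} \<subseteq> {l<..<r}"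
    by (rule order_trans[OF closure_subset])
  then have "\<eta> x = 0" if "x \<notin> {l<..<r}" for x
    using that by auto
  then have zero: "\<eta> l = 0" "\<eta> r = 0"
    by simp_all
  have "((\<lambda>x. deriv \<eta> x *\<^sub>R c) has_integral (\<eta> r *\<^sub>R c - \<eta> l *\<^sub>R c)) {l..r}"
  proof (rule fundamental_theorem_of_calculus)
    fix x
    have "(\<eta> has_vector_derivative deriv \<eta> x) (at x within {l..r})"
      by (rule has_vector_derivative_at_within[OF test_function_has_derivative(1)[OF \<eta>]])
    from bounded_linear.has_vector_derivative[OF bounded_linear_scaleR_left this]
    show "((\<lambda>x. \<eta> x *\<^sub>R c) has_vector_derivative deriv \<eta> x *\<^sub>R c) (at x within {l..r})" .
  qed (use assms in simp)
  then have "integral {l<..<r} (\<lambda>x. deriv \<eta> x *\<^sub>R c) = 0"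
    unfolding integral_open_interval_real[symmetric] by (simp add: integral_unique zero)
  then show "(LINT x|lebesgue_on {l<..<r}. deriv \<eta> x *\<^sub>R c) = - (LINT x|lebesgue_on {l<..<r}. \<eta> x *\<^sub>R 0)"
    using lebesgue_integral_eq_integral[OF test_function_deriv_integrable[OF \<eta> const_in_L2[of c]]] by simp
qed

lemma W12_diff_const:
  assumes "l < r" "(f, f') \<in> W12 {l<..<r}"
  shows "((\<lambda>x. f x - c), f') \<in> W12 {l<..<r}"
proof -
  have f: "f \<in> L2 {l<..<r}" "f' \<in> L2 {l<..<r}" "weak_deriv {l<..<r} f f'"
    using assms by (auto simp: W12_def)
  have "weak_deriv {l<..<r} (\<lambda>x. f x - c) f'"
    unfolding weak_deriv_def
  proof (intro allI impI)
    fix \<eta> assume \<eta>: "test_function {l<..<r} \<eta>"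
    have "(LINT x|lebesgue_on {l<..<r}. deriv \<eta> x *\<^sub>R (f x - c)) =
        (LINT x|lebesgue_on {l<..<r}. deriv \<eta> x *\<^sub>R f x) - (LINT x|lebesgue_on {l<..<r}. deriv \<eta> x *\<^sub>R c)"
      unfolding scaleR_diff_right by (intro Bochner_Integration.integral_diff test_function_deriv_integrable \<eta> f const_in_L2)
    also have "(LINT x|lebesgue_on {l<..<r}. deriv \<eta> x *\<^sub>R c) = 0"
      using weak_deriv_const[OF assms(1), of c] \<eta> unfolding weak_deriv_def by simp
    finally show "(LINT x|lebesgue_on {l<..<r}. deriv \<eta> x *\<^sub>R (f x - c)) = - (LINT x|lebesgue_on {l<..<r}. \<eta> x *\<^sub>R f' x)"
      using f(3) \<eta> unfolding weak_deriv_def by simp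
  qed
  with f show ?thesis
    by (auto simp: W12_def intro: L2_diff const_in_L2)
qed

lemma L2_energy_nonneg:
  assumes "f \<in> L2 X" and "\<And>x. x \<in> X \<Longrightarrow> 0 < w x"
  shows "L2_inner X (\<lambda>x. w x *\<^sub>R f x) f = complex_of_real (LINT x|lebesgue_on X. w x * (norm (f x))\<^sup>2)"
    and "0 \<le> (LINT x|lebesgue_on X. w x * (norm (f x))\<^sup>2)"
proof -
  have eq: "(w x *\<^sub>R f x) * cnj (f x) = complex_of_real (w x * (norm (f x))\<^sup>2)" for x
    by (simp add: scaleR_conv_of_real mult.assoc complex_norm_square[symmetric])
  show "L2_inner X (\<lambda>x. w x *\<^sub>R f x) f = complex_of_real (LINT x|lebesgue_on X. w x * (norm (f x))\<^sup>2)"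
    unfolding L2_inner_def eq by (rule integral_complex_of_real)
  show "0 \<le> (LINT x|lebesgue_on X. w x * (norm (f x))\<^sup>2)"
    using assms by (intro integral_nonneg_AE AE_I2) (auto simp: less_imp_le)
qed

text \<open>The pair of \<open>c\<close> and derivative 0 satisfies the variational equation, so the
  choice in \<open>A_op\<close> yields some solution \<open>\<phi>\<close>. Testing its equation
  with \<open>\<phi> - c\<close>, which has the same weak derivative as \<open>\<phi>\<close>, shows
  that the weighted energies of \<open>\<phi> - c\<close> and \<open>\<phi>'\<close> add up to 0;
  positivity of the weight then forces \<open>\<phi> = c\<close> almost everywhere.\<close>

lemma A_op_const:
  assumes "l < r" and pos: "\<And>x. x \<in> {l<..<r} \<Longrightarrow> 0 < \<zeta> x"
    and M: "AE x in lebesgue_on {l<..<r}. \<zeta> x \<le> M"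
    and meas: "\<zeta> \<in> borel_measurable (lebesgue_on {l<..<r})"
  shows "AE x in lebesgue_on {l<..<r}. A_op {l<..<r} \<zeta> (\<lambda>_. c) x = c"
proof -
  let ?X = "{l<..<r}"
  let ?P = "\<lambda>\<phi> \<phi>'. (\<phi>, \<phi>') \<in> W12 ?X \<and> (\<forall>(v, v')\<in>W12 ?X.
         L2_inner ?X (\<lambda>x. \<zeta> x *\<^sub>R \<phi> x) v + L2_inner ?X (\<lambda>x. \<zeta> x *\<^sub>R \<phi>' x) v'
           = L2_inner ?X (\<lambda>x. \<zeta> x *\<^sub>R c) v)"
  have "?P (\<lambda>_. c) (\<lambda>_. 0)"
    using assms by (auto simp: W12_def const_in_L2 weak_deriv_const L2_inner_def)
  then have "\<exists>\<phi>'. ?P (A_op ?X \<zeta> (\<lambda>_. c)) \<phi>'"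
    unfolding A_op_def
    by (intro someI[where P="\<lambda>\<phi>. \<exists>\<phi>'. ?P \<phi> \<phi>'" and x="\<lambda>_. c"] exI[of _ "\<lambda>_. 0"])
  then obtain \<phi> \<phi>' where A: "\<phi> = A_op ?X \<zeta> (\<lambda>_. c)" and P: "?P \<phi> \<phi>'"
    by blast
  define v where "v = (\<lambda>x. \<phi> x - c)"
  have v: "(v, \<phi>') \<in> W12 ?X"
    unfolding v_def using P assms by (intro W12_diff_const) auto
  have L2: "\<phi> \<in> L2 ?X" "\<phi>' \<in> L2 ?X" "v \<in> L2 ?X"
    using P v by (auto simp: W12_def)
  have M': "AE x in lebesgue_on ?X. \<bar>\<zeta> x\<bar> \<le> M"
    using M AE_space by eventually_elim (use pos in force)
  note int = L2_weighted_product_integrable[OF _ L2(3) meas M']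
  have "L2_inner ?X (\<lambda>x. \<zeta> x *\<^sub>R v x) v = L2_inner ?X (\<lambda>x. \<zeta> x *\<^sub>R \<phi> x) v - L2_inner ?X (\<lambda>x. \<zeta> x *\<^sub>R c) v"
    unfolding L2_inner_def v_def scaleR_diff_right left_diff_distrib
    by (intro Bochner_Integration.integral_diff int[unfolded v_def] L2 const_in_L2)
  also have "\<dots> = - L2_inner ?X (\<lambda>x. \<zeta> x *\<^sub>R \<phi>' x) \<phi>'"
    using P v by (auto simp: algebra_simps)
  finally have "complex_of_real (LINT x|lebesgue_on ?X. \<zeta> x * (norm (v x))\<^sup>2) =
      - complex_of_real (LINT x|lebesgue_on ?X. \<zeta> x * (norm (\<phi>' x))\<^sup>2)"
    using L2_energy_nonneg(1)[OF L2(2), of \<zeta>] L2_energy_nonneg(1)[OF L2(3), of \<zeta>] pos by simp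
  then have "(LINT x|lebesgue_on ?X. \<zeta> x * (norm (v x))\<^sup>2) = - (LINT x|lebesgue_on ?X. \<zeta> x * (norm (\<phi>' x))\<^sup>2)"
    unfolding of_real_minus[symmetric] of_real_eq_iff .
  with L2_energy_nonneg(2)[OF L2(2), of \<zeta>] L2_energy_nonneg(2)[OF L2(3), of \<zeta>] pos
  have "(LINT x|lebesgue_on ?X. \<zeta> x * (norm (v x))\<^sup>2) = 0"
    by force
  moreover have "integrable (lebesgue_on ?X) (\<lambda>x. \<zeta> x * (norm (v x))\<^sup>2)"
  proof -
    have re: "Re ((\<zeta> x *\<^sub>R v x) * cnj (v x)) = \<zeta> x * (norm (v x))\<^sup>2" for x
      unfolding cmod_power2 by (simp add: algebra_simps power2_eq_square)
    then show ?thesis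
      using integrable_Re[OF int[OF L2(3)]] unfolding re by simp
  qed
  ultimately have "AE x in lebesgue_on ?X. \<zeta> x * (norm (v x))\<^sup>2 = 0"
    using pos by (subst (asm) integral_nonneg_eq_0_iff_AE) (auto intro!: AE_I2 simp: less_imp_le)
  then show ?thesis
    unfolding A[symmetric] using AE_space
    by eventually_elim (use pos in \<open>force simp: v_def\<close>)
qed

text \<open>The constant functions are eigenfunctions for the eigenvalue \<open>1\<close>.\<close>

lemma zero_in_Sigma_exc:
  assumes "l < r" "\<And>x. x \<in> {l<..<r} \<Longrightarrow> 0 < \<zeta> x" "AE x in lebesgue_on {l<..<r}. \<zeta> x \<le> M"
    "\<zeta> \<in> borel_measurable (lebesgue_on {l<..<r})"
  shows "0 \<in> Sigma_exc {l<..<r} \<zeta>"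
proof -
  let ?X = "{l<..<r}" and ?A = "A_op {l<..<r} \<zeta>"
  have "L2_norm ?X (\<lambda>x. ?A (\<lambda>_. 1) x - 1 * 1) = 0"
  proof -
    have const: "AE x in lebesgue_on ?X. ?A (\<lambda>_. 1) x = 1"
      by (rule A_op_const[OF assms(1) _ assms(3,4)]) (rule assms(2))
    have "AE x in lebesgue_on ?X. (norm (?A (\<lambda>_. 1) x - 1 * 1))\<^sup>2 = 0"
      using const by eventually_elim simp
    then have "(LINT x|lebesgue_on ?X. (norm (?A (\<lambda>_. 1) x - 1 * 1))\<^sup>2) = 0"
      by (rule integral_eq_zero_AE)
    then show ?thesis
      by (simp add: L2_norm_def)
  qed
  moreover have "L2_norm ?X (\<lambda>_. 1) = sqrt (r - l)"
    using assms by (simp add: L2_norm_def measure_restrict_space)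
  \<comment> \<open>A nonzero vector annihilated by A - 1 contradicts boundedness below. The
    spectral value 1 corresponds to the exceptional frequency
    \<open>sqrt (inverse 1 - 1) = 0\<close>.\<close>
  ultimately have "\<not> L2_norm ?X (\<lambda>_. 1) \<le> C * L2_norm ?X (\<lambda>x. ?A (\<lambda>_. 1) x - 1 * 1)" for C
    using assms by simp
  then have "complex_of_real 1 \<in> L2_spectrum ?X ?A"
    using const_in_L2[of 1 l r] unfolding L2_spectrum_def of_real_1 by blast
  then show ?thesis
    unfolding Sigma_exc_def by (auto intro!: exI[of _ "1::real"])
qed

section \<open>Moebius transformations of the disk\<close>

text \<open>Both hypotheses are cases of one homogeneous identity with right-hand side
  \<open>\<kappa> * ((norm a)\<^sup>2 - (norm b)\<^sup>2)\<close>: the first at (1, \<xi>), the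
  second at (0, 1), which is the point \<xi> = \<infinity>. The first compares numerator and
  denominator on the disk; the second gives |\<gamma>| < |\<delta>|, which the inverse map
  needs.\<close>

lemma moebius_Aut_disk:
  fixes \<alpha> \<beta> \<gamma> \<delta> :: complex
  assumes \<kappa>: "\<kappa> > 0"
    and flux: "\<And>\<xi>. (norm (\<alpha> + \<xi> * \<gamma>))\<^sup>2 - (norm (\<beta> + \<xi> * \<delta>))\<^sup>2 = \<kappa> * (1 - (norm \<xi>)\<^sup>2)"
    and flux': "(norm \<gamma>)\<^sup>2 - (norm \<delta>)\<^sup>2 = - \<kappa>"
  shows "\<And>\<xi>. \<xi> \<in> disk \<Longrightarrow> \<alpha> + \<xi> * \<gamma> \<noteq> 0"
    and "(\<lambda>\<xi>. (\<beta> + \<xi> * \<delta>) / (\<alpha> + \<xi> * \<gamma>)) \<in> Aut_disk"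
proof -
  let ?g = "\<lambda>\<xi>. (\<beta> + \<xi> * \<delta>) / (\<alpha> + \<xi> * \<gamma>)"
  have less: "norm (\<beta> + \<xi> * \<delta>) < norm (\<alpha> + \<xi> * \<gamma>)" if "\<xi> \<in> disk" for \<xi>
  proof -
    have "(norm \<xi>)\<^sup>2 < 1"
      using that by (simp add: abs_square_less_1)
    then have "(norm (\<beta> + \<xi> * \<delta>))\<^sup>2 < (norm (\<alpha> + \<xi> * \<gamma>))\<^sup>2"
      using flux[of \<xi>] \<kappa> by (smt (verit) mult_pos_pos)
    then show ?thesis
      by (rule power_less_imp_less_base) simp
  qed
  show nz: "\<alpha> + \<xi> * \<gamma> \<noteq> 0" if "\<xi> \<in> disk" for \<xi>
    using less[OF that] by force
  have "norm \<beta> < norm \<alpha>"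
    using less[of 0] by simp
  moreover have gd: "norm \<gamma> < norm \<delta>"
    using flux' \<kappa> by (rule_tac power_less_imp_less_base[where n=2]) auto
  ultimately have "norm (\<beta> * \<gamma>) < norm (\<alpha> * \<delta>)"
    \<comment> \<open>The determinant cannot vanish because |\<beta>| < |\<alpha>| and |\<gamma>| <
      |\<delta>|.\<close>
    unfolding norm_mult by (intro mult_strict_mono') auto
  then have det: "\<alpha> * \<delta> - \<beta> * \<gamma> \<noteq> 0"
    by auto
  have "bij_betw ?g disk disk"
    unfolding bij_betw_def
  proof (intro conjI equalityI)
    show "inj_on ?g disk"
    proof (rule inj_onI)
      fix \<xi> \<eta> assume *: "\<xi> \<in> disk" "\<eta> \<in> disk" "?g \<xi> = ?g \<eta>"
      then have "(\<beta> + \<xi> * \<delta>) * (\<alpha> + \<eta> * \<gamma>) = (\<beta> + \<eta> * \<delta>) * (\<alpha> + \<xi> * \<gamma>)"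
        using nz by (simp add: frac_eq_eq)
      then have "(\<xi> - \<eta>) * (\<alpha> * \<delta> - \<beta> * \<gamma>) = 0"
        by algebra
      with det show "\<xi> = \<eta>"
        by simp
    qed
    show "?g ` disk \<subseteq> disk"
      using less nz by (auto simp: norm_divide divide_simps)
    show "disk \<subseteq> ?g ` disk"
    proof
      fix w :: complex assume w: "w \<in> disk"
      have "norm (w * \<gamma>) \<le> norm \<gamma>"
        using w by (auto simp: norm_mult intro!: mult_left_le_one_le)
      with gd have ne: "\<delta> - w * \<gamma> \<noteq> 0"
        by auto
      \<comment> \<open>The formal inverse of the Moebius map at \<open>w\<close>; it remains to see
        that it lies in the disk.\<close>
      define \<xi> where "\<xi> = (w * \<alpha> - \<beta>) / (\<delta> - w * \<gamma>)"
      have "\<xi> * (\<delta> - w * \<gamma>) = w * \<alpha> - \<beta>"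
        using ne by (simp add: \<xi>_def)
      then have eq: "\<beta> + \<xi> * \<delta> = w * (\<alpha> + \<xi> * \<gamma>)"
        by algebra
      have den: "\<alpha> + \<xi> * \<gamma> \<noteq> 0"
      proof
        assume "\<alpha> + \<xi> * \<gamma> = 0"
        with eq have "\<alpha> + \<xi> * \<gamma> = 0" "\<beta> + \<xi> * \<delta> = 0"
          by auto
        then have "\<alpha> * \<delta> - \<beta> * \<gamma> = 0"
          by algebra
        with det show False ..
      qed
      \<comment> \<open>The flux identity read backwards: \<open>w\<close> in the disk makes the
        right-hand side positive, hence |\<xi>| < 1.\<close>
      have "\<kappa> * (1 - (norm \<xi>)\<^sup>2) = (norm (\<alpha> + \<xi> * \<gamma>))\<^sup>2 * (1 - (norm w)\<^sup>2)"
        using flux[of \<xi>] unfolding eq norm_mult power_mult_distrib by (simp add: right_diff_distrib left_diff_distrib mult.commute)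
      also have "\<dots> > 0"
        using den w by (auto simp: abs_square_less_1 intro!: mult_pos_pos)
      finally have "\<xi> \<in> disk"
        using \<kappa> by (simp add: zero_less_mult_iff abs_square_less_1)
      moreover have "?g \<xi> = w"
        using den by (simp add: eq)
      ultimately show "w \<in> ?g ` disk"
        by blast
    qed
  qed
  moreover have "?g holomorphic_on disk"
    using nz by (intro holomorphic_intros) auto
  ultimately show "?g \<in> Aut_disk"
    by (simp add: Aut_disk_def)
qed

section \<open>Conservation of the flux\<close>

lemma absolutely_continuous_on_dominated:
  assumes f: "absolutely_continuous_on X f" and g: "absolutely_continuous_on X g"
    and h: "\<And>x y. x \<in> X \<Longrightarrow> y \<in> X \<Longrightarrow> norm (h y - h x) \<le> L * (norm (f y - f x) + norm (g y - g x))"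
  shows "absolutely_continuous_on X h"
  unfolding absolutely_continuous_on_def
proof (intro allI impI)
  fix e :: real assume "e > 0"
  define k where "k = \<bar>L\<bar> + 1"
  have k: "k > 0"
    unfolding k_def by (rule add_nonneg_pos) auto
  define e' where "e' = e / (2 * k)"
  have "2 * k * e' = e" "e' > 0"
    using k \<open>e > 0\<close> by (auto simp: e'_def)
  then have e': "e' > 0" "k * (e' + e') = e"
    by (simp_all add: algebra_simps)
  let ?A = "\<lambda>P d. finite P \<and> (\<forall>(a, b)\<in>P. a \<le> b \<and> {a..b} \<subseteq> X) \<and>
       disjoint_family_on (\<lambda>(a, b). {a<..<b}) P \<and> (\<Sum>(a, b)\<in>P. b - a) < d"
  obtain d1 where d1: "d1 > 0" "\<And>P. ?A P d1 \<Longrightarrow> (\<Sum>(a, b)\<in>P. norm (f b - f a)) < e'"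
    using f e' unfolding absolutely_continuous_on_def by meson
  obtain d2 where d2: "d2 > 0" "\<And>P. ?A P d2 \<Longrightarrow> (\<Sum>(a, b)\<in>P. norm (g b - g a)) < e'"
    using g e' unfolding absolutely_continuous_on_def by meson
  show "\<exists>d>0. \<forall>P. ?A P d \<longrightarrow> (\<Sum>(a, b)\<in>P. norm (h b - h a)) < e"
  proof (rule exI[of _ "min d1 d2"], intro conjI allI impI)
    fix P assume P: "?A P (min d1 d2)"
    have "(\<Sum>(a, b)\<in>P. norm (h b - h a)) \<le>
        (\<Sum>(a, b)\<in>P. k * (norm (f b - f a) + norm (g b - g a)))"
    proof (intro sum_mono, clarify)
      fix a b assume "(a, b) \<in> P"
      with P have "a \<in> X" "b \<in> X"
        by force+
      then have "norm (h b - h a) \<le> L * (norm (f b - f a) + norm (g b - g a))"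
        by (rule h)
      also have "\<dots> \<le> k * (norm (f b - f a) + norm (g b - g a))"
        by (intro mult_right_mono) (auto simp: k_def)
      finally show "norm (h b - h a) \<le> k * (norm (f b - f a) + norm (g b - g a))" .
    qed
    also have "\<dots> = k * ((\<Sum>(a, b)\<in>P. norm (f b - f a)) + (\<Sum>(a, b)\<in>P. norm (g b - g a)))"
      by (simp add: split_def sum.distrib flip: sum_distrib_left)
    also have "\<dots> < k * (e' + e')"
      using d1(2)[of P] d2(2)[of P] P k by (intro mult_strict_left_mono add_strict_mono) auto
    finally show "(\<Sum>(a, b)\<in>P. norm (h b - h a)) < e"
      using e' by simp
  qed (use d1 d2 in auto)
qed

lemma absolutely_continuous_on_lincomb:
  assumes "absolutely_continuous_on X f" "absolutely_continuous_on X g"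
  shows "absolutely_continuous_on X (\<lambda>x. a * f x + b * g x)"
proof (rule absolutely_continuous_on_dominated[OF assms])
  fix x y
  have "norm (a * f y + b * g y - (a * f x + b * g x)) = norm (a * (f y - f x) + b * (g y - g x))"
    by (simp add: algebra_simps)
  also have "\<dots> \<le> norm a * norm (f y - f x) + norm b * norm (g y - g x)"
    by (metis norm_mult norm_triangle_ineq)
  also have "\<dots> \<le> (norm a + norm b) * (norm (f y - f x) + norm (g y - g x))"
    by (simp add: algebra_simps)
  finally show "norm (a * f y + b * g y - (a * f x + b * g x)) \<le>
      (norm a + norm b) * (norm (f y - f x) + norm (g y - g x))" .
qed

text \<open>Families consisting of one interval already give uniform continuity, hence boundedness
  on a bounded interval; the product estimate needs these bounds.\<close>

lemma absolutely_continuous_on_bounded: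
  assumes "absolutely_continuous_on {l<..<r} f"
  shows "bounded (f ` {l<..<r})"
proof (rule bounded_uniformly_continuous_image)
  have aux: "\<exists>d>0. \<forall>x\<in>{l<..<r}. \<forall>y\<in>{l<..<r}. x \<le> y \<longrightarrow> y - x < d \<longrightarrow> norm (f y - f x) < e"
    if "e > 0" for e
  proof -
    obtain d where d: "d > 0" "\<And>P :: (real \<times> real) set. finite P \<and> (\<forall>(a, b)\<in>P. a \<le> b \<and> {a..b} \<subseteq> {l<..<r}) \<and>
       disjoint_family_on (\<lambda>(a, b). {a<..<b}) P \<and> (\<Sum>(a, b)\<in>P. b - a) < d \<Longrightarrow>
       (\<Sum>(a, b)\<in>P. norm (f b - f a)) < e"
      using assms \<open>e > 0\<close> unfolding absolutely_continuous_on_def by meson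
    have "norm (f y - f x) < e" if "x \<in> {l<..<r}" "y \<in> {l<..<r}" "x \<le> y" "y - x < d" for x y
    proof -
      have "{x..y} \<subseteq> {l<..<r}"
        using that by auto
      then show ?thesis
        using d(2)[of "{(x, y)}"] that by (auto simp: disjoint_family_on_def)
    qed
    with d show ?thesis
      by blast
  qed
  show "uniformly_continuous_on {l<..<r} f"
    unfolding uniformly_continuous_on_def
  proof (intro allI impI)
    fix e :: real assume "e > 0"
    then obtain d where d: "d > 0"
      "\<And>x y. x \<in> {l<..<r} \<Longrightarrow> y \<in> {l<..<r} \<Longrightarrow> x \<le> y \<Longrightarrow> y - x < d \<Longrightarrow> norm (f y - f x) < e"
      using aux by metis
    have "dist (f y) (f x) < e" if "x \<in> {l<..<r}" "y \<in> {l<..<r}" "dist y x < d" for x y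
      using d(2)[of x y] d(2)[of y x] that
      by (cases "x \<le> y") (auto simp: dist_norm norm_minus_commute)
    with d show "\<exists>d>0. \<forall>x\<in>{l<..<r}. \<forall>x'\<in>{l<..<r}. dist x' x < d \<longrightarrow> dist (f x') (f x) < e"
      by blast
  qed
qed simp

lemma absolutely_continuous_on_mult_cnj:
  assumes f: "absolutely_continuous_on {l<..<r} f" and g: "absolutely_continuous_on {l<..<r} g"
  shows "absolutely_continuous_on {l<..<r} (\<lambda>x. f x * cnj (g x))"
proof -
  obtain M where M: "M > 0" "\<forall>x\<in>{l<..<r}. norm (f x) \<le> M"
    using absolutely_continuous_on_bounded[OF f] unfolding bounded_pos by auto
  obtain N where N: "N > 0" "\<forall>x\<in>{l<..<r}. norm (g x) \<le> N"
    using absolutely_continuous_on_bounded[OF g] unfolding bounded_pos by auto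
  show ?thesis
  proof (rule absolutely_continuous_on_dominated[OF f g])
    fix x y assume xy: "x \<in> {l<..<r}" "y \<in> {l<..<r}"
    have "f y * cnj (g y) - f x * cnj (g x) = (f y - f x) * cnj (g y) + f x * cnj (g y - g x)"
      by (simp add: algebra_simps)
    also have "norm \<dots> \<le> norm (f y - f x) * norm (g y) + norm (f x) * norm (g y - g x)"
      by (metis norm_mult norm_triangle_ineq complex_mod_cnj)
    also have "\<dots> \<le> norm (f y - f x) * N + M * norm (g y - g x)"
      using M N xy by (intro add_mono mult_mono) auto
    also have "\<dots> \<le> (M + N) * (norm (f y - f x) + norm (g y - g x))"
      using M N by (simp add: algebra_simps)
    finally show "norm (f y * cnj (g y) - f x * cnj (g x)) \<le> (M + N) * (norm (f y - f x) + norm (g y - g x))" .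
  qed
qed

text \<open>The differential equation as a first-order system for \<open>u\<close> and \<open>p = \<zeta> u'\<close>.\<close>

definition ode_pair ::
  "real \<Rightarrow> real \<Rightarrow> (real \<Rightarrow> real) \<Rightarrow> real \<Rightarrow> (real \<Rightarrow> complex) \<Rightarrow> (real \<Rightarrow> complex) \<Rightarrow> bool" where
  "ode_pair l r \<zeta> \<omega> u p \<longleftrightarrow>
    absolutely_continuous_on {l<..<r} u \<and> absolutely_continuous_on {l<..<r} p \<and>
    (AE x in lebesgue_on {l<..<r}. (u has_vector_derivative p x /\<^sub>R \<zeta> x) (at x) \<and>
       (p has_vector_derivative - ((\<omega>\<^sup>2 * \<zeta> x) *\<^sub>R u x)) (at x))"

text \<open>With this symmetry, facts about \<open>u_left\<close> with a free frequency
  \<open>\<nu>\<close> cover both amplitudes: \<open>\<nu> = \<omega>\<close> for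
  \<open>u_left\<close> and \<open>\<nu> = - \<omega>\<close> for \<open>u_right\<close>.\<close>

lemma u_right_eq_u_left: "u_right \<omega> u = u_left (- \<omega>) u"
  by (simp add: u_right_def u_left_def fun_eq_iff)

lemma ode_pair_lincomb:
  assumes "ode_pair l r \<zeta> \<omega> u p" "ode_pair l r \<zeta> \<omega> v q"
  shows "ode_pair l r \<zeta> \<omega> (\<lambda>x. a * u x + b * v x) (\<lambda>x. a * p x + b * q x)"
proof -
  have "AE x in lebesgue_on {l<..<r}. (u has_vector_derivative p x /\<^sub>R \<zeta> x) (at x) \<and>
       (p has_vector_derivative - ((\<omega>\<^sup>2 * \<zeta> x) *\<^sub>R u x)) (at x)"
    "AE x in lebesgue_on {l<..<r}. (v has_vector_derivative q x /\<^sub>R \<zeta> x) (at x) \<and>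
       (q has_vector_derivative - ((\<omega>\<^sup>2 * \<zeta> x) *\<^sub>R v x)) (at x)"
    using assms by (auto simp: ode_pair_def)
  then have "AE x in lebesgue_on {l<..<r}.
      ((\<lambda>x. a * u x + b * v x) has_vector_derivative (a * p x + b * q x) /\<^sub>R \<zeta> x) (at x) \<and>
      ((\<lambda>x. a * p x + b * q x) has_vector_derivative - ((\<omega>\<^sup>2 * \<zeta> x) *\<^sub>R (a * u x + b * v x))) (at x)"
  proof eventually_elim
    case (elim x)
    then have u: "(u has_vector_derivative p x /\<^sub>R \<zeta> x) (at x)"
      and p: "(p has_vector_derivative - ((\<omega>\<^sup>2 * \<zeta> x) *\<^sub>R u x)) (at x)"
      and v: "(v has_vector_derivative q x /\<^sub>R \<zeta> x) (at x)"
      and q: "(q has_vector_derivative - ((\<omega>\<^sup>2 * \<zeta> x) *\<^sub>R v x)) (at x)"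
      by auto
    have "((\<lambda>x. a * u x + b * v x) has_vector_derivative a * (p x /\<^sub>R \<zeta> x) + b * (q x /\<^sub>R \<zeta> x)) (at x)"
      by (intro has_vector_derivative_add has_vector_derivative_mult_right u v)
    moreover have "((\<lambda>x. a * p x + b * q x) has_vector_derivative
        a * - ((\<omega>\<^sup>2 * \<zeta> x) *\<^sub>R u x) + b * - ((\<omega>\<^sup>2 * \<zeta> x) *\<^sub>R v x)) (at x)"
      by (intro has_vector_derivative_add has_vector_derivative_mult_right p q)
    ultimately show ?case
      by (simp add: scaleR_right_distrib)
  qed
  then show ?thesis
    using assms by (auto simp: ode_pair_def intro: absolutely_continuous_on_lincomb)
qed

lemma ode_pair_u_left:
  assumes "ode_pair l r \<zeta> \<omega> u p"
  shows "AE x in lebesgue_on {l<..<r}. u_left \<nu> u x = (u x - (p x /\<^sub>R \<zeta> x) / (\<i> * complex_of_real \<nu>)) / 2"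
proof -
  have "AE x in lebesgue_on {l<..<r}. (u has_vector_derivative p x /\<^sub>R \<zeta> x) (at x)"
    using assms by (auto simp: ode_pair_def)
  then show ?thesis
  proof eventually_elim
    case (elim x)
    have "1 / 2 * (a - 1 / b * v) = (a - v / b) / 2" for a b v :: complex
      by simp
    then show ?case
      unfolding u_left_def vector_derivative_at[OF elim] .
  qed
qed

lemma ode_pair_u_left_lincomb:
  assumes "ode_pair l r \<zeta> \<omega> u p" "ode_pair l r \<zeta> \<omega> v q"
  shows "AE x in lebesgue_on {l<..<r}.
    u_left \<nu> (\<lambda>x. a * u x + b * v x) x = a * u_left \<nu> u x + b * u_left \<nu> v x"
  using ode_pair_u_left[OF assms(1), of \<nu>] ode_pair_u_left[OF assms(2), of \<nu>]
    ode_pair_u_left[OF ode_pair_lincomb[OF assms, of a b], of \<nu>]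
proof eventually_elim
  case (elim x)
  show ?case
    unfolding elim by (simp add: scaleR_right_distrib add_divide_distrib diff_divide_distrib algebra_simps)
qed

lemma ode_pair_flux:
  assumes ode: "ode_pair l r \<zeta> \<omega> u p" and "l < r" and pos: "\<And>x. x \<in> {l<..<r} \<Longrightarrow> 0 < \<zeta> x" and "\<omega> \<noteq> 0"
  shows "\<exists>c. AE x in lebesgue_on {l<..<r}. \<zeta> x * ((norm (u_right \<omega> u x))\<^sup>2 - (norm (u_left \<omega> u x))\<^sup>2) = c"
proof -
  \<comment> \<open>\<open>F\<close> is -2 \<i> times the imaginary part of
    \<open>cnj u * p\<close>; the explicit coefficients match the shape of
    \<open>absolutely_continuous_on_lincomb\<close>.\<close>
  define F where "F = (\<lambda>x. 1 * (u x * cnj (p x)) + (- 1) * (p x * cnj (u x)))"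
  have ac: "absolutely_continuous_on {l<..<r} u" "absolutely_continuous_on {l<..<r} p"
    using ode by (auto simp: ode_pair_def)
  have F_ac: "absolutely_continuous_on {l<..<r} F"
    unfolding F_def by (intro absolutely_continuous_on_lincomb absolutely_continuous_on_mult_cnj ac)
  have "AE x in lebesgue_on {l<..<r}. (u has_vector_derivative p x /\<^sub>R \<zeta> x) (at x) \<and>
       (p has_vector_derivative - ((\<omega>\<^sup>2 * \<zeta> x) *\<^sub>R u x)) (at x)"
    using ode by (auto simp: ode_pair_def)
  then have "AE x in lebesgue_on {l<..<r}. (F has_vector_derivative 0) (at x)"
  proof eventually_elim
    case (elim x)
    then have u: "(u has_vector_derivative p x /\<^sub>R \<zeta> x) (at x)"
      and p: "(p has_vector_derivative - ((\<omega>\<^sup>2 * \<zeta> x) *\<^sub>R u x)) (at x)"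
      by auto
    have "((\<lambda>x. u x * cnj (p x)) has_vector_derivative
        u x * cnj (- ((\<omega>\<^sup>2 * \<zeta> x) *\<^sub>R u x)) + (p x /\<^sub>R \<zeta> x) * cnj (p x)) (at x)"
      by (rule has_vector_derivative_mult[OF u has_vector_derivative_cnj[OF p]])
    moreover have "((\<lambda>x. p x * cnj (u x)) has_vector_derivative
        p x * cnj (p x /\<^sub>R \<zeta> x) + - ((\<omega>\<^sup>2 * \<zeta> x) *\<^sub>R u x) * cnj (u x)) (at x)"
      by (rule has_vector_derivative_mult[OF p has_vector_derivative_cnj[OF u]])
    \<comment> \<open>Since \<zeta> and \<omega> are real, both products have the derivative |p|^2 /
      \<zeta> - \<omega>^2 \<zeta> |u|^2, and the difference cancels.\<close>
    ultimately show ?case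
      unfolding F_def
      by (intro has_vector_derivative_eq_rhs[OF has_vector_derivative_add[OF
            has_vector_derivative_mult_right has_vector_derivative_mult_right]]) auto
  qed
  note F_const = absolutely_continuous_on_diff_eq_0[OF F_ac this]
  define m where "m = (l + r) / 2"
  have m: "m \<in> {l<..<r}"
    using \<open>l < r\<close> by (auto simp: m_def)
  have F_m: "F x = F m" if "x \<in> {l<..<r}" for x
    using F_const[of x m] F_const[of m x] m that by (cases "x \<le> m") auto
  have "AE x in lebesgue_on {l<..<r}. \<zeta> x * ((norm (u_right \<omega> u x))\<^sup>2 - (norm (u_left \<omega> u x))\<^sup>2) = - Im (F m) / (2 * \<omega>)"
    using ode_pair_u_left[OF ode, of \<omega>] ode_pair_u_left[OF ode, of "- \<omega>"] AE_space
  proof eventually_elim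
    case (elim x)
    then have x: "x \<in> {l<..<r}"
      by simp
    define v where "v = p x /\<^sub>R \<zeta> x"
    have pv: "p x = of_real (\<zeta> x) * v"
      using pos[OF x] by (simp add: v_def scaleR_conv_of_real)
    have eq: "(norm (u_right \<omega> u x))\<^sup>2 - (norm (u_left \<omega> u x))\<^sup>2 = (Im v * Re (u x) - Re v * Im (u x)) / \<omega>"
    proof -
      \<comment> \<open>With this \<open>w\<close> the two amplitudes are (u + w) / 2 and (u - w) /
        2, so the difference of their squared moduli is the real part of
        \<open>w * cnj (u x)\<close>.\<close>
      define w where "w = v / (\<i> * complex_of_real \<omega>)"
      have "v = w * (\<i> * complex_of_real \<omega>)" "v / (\<i> * complex_of_real (- \<omega>)) = - w"
        using \<open>\<omega> \<noteq> 0\<close> by (simp_all add: w_def)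
      moreover have "(norm ((u x + w) / 2))\<^sup>2 - (norm ((u x - w) / 2))\<^sup>2 = Re w * Re (u x) + Im w * Im (u x)"
        unfolding norm_divide power_divide cmod_power2 by (simp add: power2_eq_square field_simps)
      ultimately show ?thesis
        unfolding u_right_eq_u_left elim v_def[symmetric] w_def[symmetric]
        using \<open>\<omega> \<noteq> 0\<close> by (simp add: field_simps)
    qed
    have "\<zeta> x * ((norm (u_right \<omega> u x))\<^sup>2 - (norm (u_left \<omega> u x))\<^sup>2) = - Im (F x) / (2 * \<omega>)"
      unfolding eq using \<open>\<omega> \<noteq> 0\<close> by (simp add: F_def pv field_simps)
    then show ?case
      using F_m[OF x] by simp
  qed
  then show ?thesis ..
qed

lemma ode_pair_flux_boundary:
  assumes "ode_pair l r \<zeta> \<omega> u p" and lr: "l < r" and "\<And>x. x \<in> {l<..<r} \<Longrightarrow> 0 < \<zeta> x" and "\<omega> \<noteq> 0"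
    and left: "(\<zeta> \<longlongrightarrow> z0) (ess_at_right l)" "(u_right \<omega> u \<longlongrightarrow> r0) (ess_at_right l)" "(u_left \<omega> u \<longlongrightarrow> l0) (ess_at_right l)"
    and right: "(\<zeta> \<longlongrightarrow> z1) (ess_at_left r)" "(u_right \<omega> u \<longlongrightarrow> r1) (ess_at_left r)" "(u_left \<omega> u \<longlongrightarrow> l1) (ess_at_left r)"
  shows "z0 * ((norm r0)\<^sup>2 - (norm l0)\<^sup>2) = z1 * ((norm r1)\<^sup>2 - (norm l1)\<^sup>2)"
proof -
  let ?J = "\<lambda>x. \<zeta> x * ((norm (u_right \<omega> u x))\<^sup>2 - (norm (u_left \<omega> u x))\<^sup>2)"
  obtain c where c: "AE x in lebesgue_on {l<..<r}. ?J x = c"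
    using ode_pair_flux[OF assms(1) lr _ assms(4)] assms(3) by blast
  have "(?J \<longlongrightarrow> z0 * ((norm r0)\<^sup>2 - (norm l0)\<^sup>2)) (ess_at_right l)"
    by (intro tendsto_intros left)
  from tendsto_unique[OF ess_at_right_neq_bot this tendsto_eventually[OF eventually_ess_at_rightI[OF c lr]]]
  have "z0 * ((norm r0)\<^sup>2 - (norm l0)\<^sup>2) = c" .
  moreover have "(?J \<longlongrightarrow> z1 * ((norm r1)\<^sup>2 - (norm l1)\<^sup>2)) (ess_at_left r)"
    by (intro tendsto_intros right)
  from tendsto_unique[OF ess_at_left_neq_bot this tendsto_eventually[OF eventually_ess_at_leftI[OF c lr]]]
  have "z1 * ((norm r1)\<^sup>2 - (norm l1)\<^sup>2) = c" .
  ultimately show ?thesis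
    by simp
qed

text \<open>Positivity of \<open>\<zeta>\<close> allows p = \<zeta> u' to be solved for u', which
  merges differentiability and the value of the derivative into one statement and yields a linear
  system.\<close>

lemma is_solution_iff_ode_pair:
  assumes pos: "\<And>x. x \<in> {l<..<r} \<Longrightarrow> 0 < \<zeta> x"
  shows "is_solution l r \<zeta> \<omega> \<xi> u \<longleftrightarrow> (\<exists>p. ode_pair l r \<zeta> \<omega> u p) \<and>
    (u_right \<omega> u \<longlongrightarrow> 1) (ess_at_right l) \<and>
    (\<exists>c. (u_right \<omega> u \<longlongrightarrow> c) (ess_at_left r) \<and> (u_left \<omega> u \<longlongrightarrow> \<xi> * c) (ess_at_left r))"
proof -
  have 1: "(u differentiable (at x) \<and> p x = \<zeta> x *\<^sub>R vector_derivative u (at x)) \<longleftrightarrow>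
      (u has_vector_derivative p x /\<^sub>R \<zeta> x) (at x)" if "x \<in> {l<..<r}" for p x
  proof -
    have "p x = \<zeta> x *\<^sub>R v \<longleftrightarrow> v = p x /\<^sub>R \<zeta> x" for v
    proof
      assume "p x = \<zeta> x *\<^sub>R v"
      then show "v = p x /\<^sub>R \<zeta> x"
        using pos[OF that] by simp
    next
      assume "v = p x /\<^sub>R \<zeta> x"
      then show "p x = \<zeta> x *\<^sub>R v"
        using pos[OF that] by simp
    qed
    then have eq: "p x = \<zeta> x *\<^sub>R vector_derivative u (at x) \<longleftrightarrow> vector_derivative u (at x) = p x /\<^sub>R \<zeta> x" .
    show ?thesis
      unfolding eq
    proof
      assume "(u has_vector_derivative p x /\<^sub>R \<zeta> x) (at x)"
      then show "u differentiable (at x) \<and> vector_derivative u (at x) = p x /\<^sub>R \<zeta> x"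
        by (intro conjI differentiableI_vector vector_derivative_at)
    next
      assume *: "u differentiable (at x) \<and> vector_derivative u (at x) = p x /\<^sub>R \<zeta> x"
      have "(u has_vector_derivative vector_derivative u (at x)) (at x)"
        using *[THEN conjunct1] unfolding vector_derivative_works .
      then show "(u has_vector_derivative p x /\<^sub>R \<zeta> x) (at x)"
        unfolding *[THEN conjunct2] .
    qed
  qed
  have 2: "(\<exists>p'. (p has_vector_derivative p') (at x) \<and> p' + (\<omega>\<^sup>2 * \<zeta> x) *\<^sub>R u x = 0) \<longleftrightarrow>
      (p has_vector_derivative - ((\<omega>\<^sup>2 * \<zeta> x) *\<^sub>R u x)) (at x)" for p x
    by (auto simp: eq_neg_iff_add_eq_0[symmetric])
  have 3: "(AE x in lebesgue_on {l<..<r}. u differentiable (at x) \<and> p x = \<zeta> x *\<^sub>R vector_derivative u (at x)) \<longleftrightarrow>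
      (AE x in lebesgue_on {l<..<r}. (u has_vector_derivative p x /\<^sub>R \<zeta> x) (at x))" for p
    by (rule AE_cong) (simp add: 1)
  have ex: "(U \<and> (\<exists>p. P p \<and> Q p \<and> R p) \<and> S) \<longleftrightarrow> (\<exists>p. U \<and> P p \<and> Q p \<and> R p) \<and> S"
    for U S and P Q R :: "(real \<Rightarrow> complex) \<Rightarrow> bool"
    by blast
  show ?thesis
    unfolding is_solution_def ode_pair_def 2 3 unfolding AE_conj_iff by (rule ex)
qed

section \<open>The reflection coefficient\<close>

locale regulated_impedance =
  fixes l r \<omega> m M z0 z1 :: real and \<zeta> :: "real \<Rightarrow> real"
  assumes lr: "l < r" and \<omega>: "\<omega> \<noteq> 0" and m: "m > 0"
    and lower: "\<And>x. x \<in> {l<..<r} \<Longrightarrow> m < \<zeta> x"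
    and upper: "AE x in lebesgue_on {l<..<r}. \<zeta> x \<le> M"
    and meas: "\<zeta> \<in> borel_measurable (lebesgue_on {l<..<r})"
    and z0: "z0 > 0" "(\<zeta> \<longlongrightarrow> z0) (ess_at_right l)"
    and z1: "z1 > 0" "(\<zeta> \<longlongrightarrow> z1) (ess_at_left r)"
    and ess_cont: "AE x in lebesgue_on {l<..<r}. (\<zeta> \<longlongrightarrow> \<zeta> x) (inf (at x) (ae_filter lebesgue))"
begin

section \<open>Solutions with prescribed data at the right end\<close>

lemma pos: "x \<in> {l<..<r} \<Longrightarrow> 0 < \<zeta> x"
  using lower[of x] m by simp

text \<open>The contraction argument needs coefficient bounds at every point of the closed interval,
  whereas \<open>\<zeta>\<close> is bounded above only almost everywhere on the open one. Clipping
  repairs this without losing essential continuity. The upper level \<open>max m M\<close> is at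
  least \<open>m\<close> by construction.\<close>

lemma truncation:
  obtains Z where "Z \<in> borel_measurable lebesgue" "\<And>x. m \<le> Z x" "\<And>x. Z x \<le> max m M"
    "AE x in lebesgue_on {l<..<r}. Z x = \<zeta> x \<and> (Z \<longlongrightarrow> Z x) (inf (at x) (ae_filter lebesgue))"
proof -
  define Z where "Z x = max m (min (max m M) (if x \<in> {l<..<r} then \<zeta> x else 0))" for x
  have "(\<lambda>x. if x \<in> {l<..<r} then \<zeta> x else 0) \<in> borel_measurable lebesgue"
    using meas by (subst borel_measurable_if) auto
  then have "Z \<in> borel_measurable lebesgue"
    unfolding Z_def by (intro borel_measurable_max borel_measurable_min borel_measurable_const)
  moreover have eq: "AE x in lebesgue_on {l<..<r}. Z x = \<zeta> x"
    using upper AE_space by eventually_elim (use lower in \<open>force simp: Z_def\<close>)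
  have "AE x in lebesgue_on {l<..<r}. Z x = \<zeta> x \<and> (Z \<longlongrightarrow> Z x) (inf (at x) (ae_filter lebesgue))"
    using eq ess_cont AE_space
  proof eventually_elim
    case (elim x)
    then have "eventually (\<lambda>t. t \<in> {l<..<r}) (at x)"
      by (intro eventually_at_in_open') auto
    then have "eventually (\<lambda>t. \<zeta> t = Z t) (inf (at x) (ae_filter lebesgue))"
      using eq[unfolded AE_lebesgue_on_iff] by (rule eventually_inf_ae_filterI) auto
    then have "(Z \<longlongrightarrow> \<zeta> x) (inf (at x) (ae_filter lebesgue))"
      using elim(2) by (rule Lim_transform_eventually[rotated])
    with elim show ?case
      by simp
  qed
  ultimately show ?thesis
    by (intro that[of Z]) (auto simp: Z_def)
qed

lemma ode_pair_exists:
  obtains u p d0 d1 where "ode_pair l r \<zeta> \<omega> u p"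
    "(u \<longlongrightarrow> c0) (at_left r)" "(p \<longlongrightarrow> c1) (at_left r)"
    "(u \<longlongrightarrow> d0) (at_right l)" "(p \<longlongrightarrow> d1) (at_right l)"
proof -
  obtain Z where Z: "Z \<in> borel_measurable lebesgue" "\<And>x. m \<le> Z x" "\<And>x. Z x \<le> max m M"
    and Z_ae: "AE x in lebesgue_on {l<..<r}. Z x = \<zeta> x \<and> (Z \<longlongrightarrow> Z x) (inf (at x) (ae_filter lebesgue))"
    by (rule truncation) (rule that; assumption)
  have Z_pos: "Z x > 0" for x
    using Z(2)[of x] m by simp
  define G :: "real \<Rightarrow> complex \<times> complex \<Rightarrow> complex \<times> complex"
    where "G t y = (snd y /\<^sub>R Z t, - ((\<omega>\<^sup>2 * Z t) *\<^sub>R fst y))" for t y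
  \<comment> \<open>The two components of \<open>G\<close> are bounded by means of 1 / Z \<le> 1 / m
    and Z \<le> max m M. As \<open>G\<close> is linear in \<open>y\<close>, the bound is also its
    Lipschitz constant.\<close>
  define B where "B = inverse m + \<omega>\<^sup>2 * max m M"
  have B: "B > 0"
    unfolding B_def using m by (intro add_pos_nonneg mult_nonneg_nonneg) auto
  have G_bound: "norm (G t y) \<le> B * norm y" for t y
  proof -
    have "norm (G t y) \<le> norm (snd y /\<^sub>R Z t) + norm (- ((\<omega>\<^sup>2 * Z t) *\<^sub>R fst y))"
      unfolding G_def by (rule norm_Pair_le)
    also have "\<dots> = inverse (Z t) * norm (snd y) + \<omega>\<^sup>2 * Z t * norm (fst y)"
      using Z_pos[of t] by (simp add: abs_mult)
    also have "\<dots> \<le> inverse m * norm y + \<omega>\<^sup>2 * max m M * norm y"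
      using Z(2,3)[of t] Z_pos[of t] m
      by (intro add_mono mult_mono le_imp_inverse_le norm_fst_le norm_snd_le mult_nonneg_nonneg) 
        (auto intro: norm_fst_le[of "fst y" "snd y", simplified] norm_snd_le[of "snd y" "fst y", simplified])
    finally show ?thesis
      by (simp add: B_def distrib_right)
  qed
  have G_diff: "G t y - G t z = G t (y - z)" for t y z
    by (simp add: G_def scaleR_diff_right)
  have G_int: "(\<lambda>t. G t (y t)) integrable_on {l..r}" if y: "continuous_on {l..r} y" for y
  proof -
    have "bounded (y ` {l..r})"
      using y by (intro compact_imp_bounded compact_continuous_image) auto
    then obtain K where K: "\<forall>t\<in>{l..r}. norm (y t) \<le> K"
      unfolding bounded_iff by auto
    have [measurable]: "Z \<in> borel_measurable (lebesgue_on {l..r})"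
      using Z(1) by (rule measurable_restrict_space1)
    have [measurable]: "y \<in> borel_measurable (lebesgue_on {l..r})"
      using y by (intro continuous_imp_measurable_on_sets_lebesgue) auto
    have [measurable]: "(\<lambda>t. fst (y t)) \<in> borel_measurable (lebesgue_on {l..r})"
      "(\<lambda>t. snd (y t)) \<in> borel_measurable (lebesgue_on {l..r})"
      using y by (intro continuous_imp_measurable_on_sets_lebesgue continuous_intros; simp)+
    show ?thesis
    proof (rule measurable_bounded_by_integrable_imp_integrable)
      show "(\<lambda>t. G t (y t)) \<in> borel_measurable (lebesgue_on {l..r})"
        unfolding G_def by (intro borel_measurable_Pair) measurable
      show "(\<lambda>_. B * K) integrable_on {l..r}"
        by (rule integrable_const_ivl)
      show "norm (G t (y t)) \<le> B * K" if "t \<in> {l..r}" for t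
        using G_bound[of t "y t"] mult_left_mono[of "norm (y t)" K B] K[rule_format, OF that] B by linarith
    qed simp
  qed
  obtain y where y: "continuous_on {l..r} y"
    and y_eq: "\<And>x. x \<in> {l..r} \<Longrightarrow> y x = (c0, c1) - integral {x..r} (\<lambda>t. G t (y t))"
  proof (rule integral_equation_solution[of l r B G "(c0, c1)"])
    show "norm (G t y - G t z) \<le> B * norm (y - z)" for t y z
      unfolding G_diff by (rule G_bound)
  qed (use lr B G_int in auto)
  define u where "u x = fst (y x)" for x
  define p where "p x = snd (y x)" for x
  have fun_eq: "u = (\<lambda>x. fst (y x))" "p = (\<lambda>x. snd (y x))"
    by (simp_all add: u_def p_def fun_eq_iff)
  have cont: "continuous_on {l..r} u" "continuous_on {l..r} p"
    unfolding u_def p_def by (intro continuous_intros y)+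
  have "bounded (y ` {l..r})"
    using y by (intro compact_imp_bounded compact_continuous_image) auto
  then obtain K where K: "\<forall>t\<in>{l..r}. norm (y t) \<le> K"
    unfolding bounded_iff by auto
  \<comment> \<open>The integrand is bounded by \<open>B * K\<close> along the continuous solution,
    so \<open>y\<close> is Lipschitz; this gives absolute continuity of both components.\<close>
  have lip: "norm (y x' - y x) \<le> B * K * (x' - x)" if "x \<in> {l<..<r}" "x' \<in> {l<..<r}" "x \<le> x'" for x x'
  proof -
    have int: "(\<lambda>t. G t (y t)) integrable_on {x..r}" "(\<lambda>t. G t (y t)) integrable_on {x..x'}"
      using that by (auto intro: integrable_subinterval_real[OF G_int[OF y]])
    have "y x' - y x = integral {x..x'} (\<lambda>t. G t (y t))"
      using Henstock_Kurzweil_Integration.integral_combine[OF _ _ int(1), of x'] that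
      by (subst (1 2) y_eq) (auto simp: algebra_simps)
    also have "norm \<dots> \<le> integral {x..x'} (\<lambda>t. B * K)"
    proof (rule integral_norm_bound_integral[OF int(2) integrable_const_ivl])
      show "norm (G t (y t)) \<le> B * K" if "t \<in> {x..x'}" for t
      proof -
        have "norm (y t) \<le> K"
          using K that \<open>x \<in> {l<..<r}\<close> \<open>x' \<in> {l<..<r}\<close> by simp
        then show ?thesis
          using G_bound[of t "y t"] mult_left_mono[of "norm (y t)" K B] B by linarith
      qed
    qed
    finally show ?thesis
      using that by (simp add: ac_simps)
  qed
  have le: "norm (u x' - u x) \<le> norm (y x' - y x)" "norm (p x' - p x) \<le> norm (y x' - y x)" for x x'
    unfolding u_def p_def fst_diff[symmetric] snd_diff[symmetric]
    by (metis norm_fst_le norm_snd_le surjective_pairing)+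
  have ac: "absolutely_continuous_on {l<..<r} u" "absolutely_continuous_on {l<..<r} p"
    by (rule lipschitz_imp_absolutely_continuous_on[of _ _ "B * K"],
        rule order_trans[OF le(1) lip] order_trans[OF le(2) lip]; assumption)+
  have "AE x in lebesgue_on {l<..<r}. (u has_vector_derivative p x /\<^sub>R \<zeta> x) (at x) \<and>
       (p has_vector_derivative - ((\<omega>\<^sup>2 * \<zeta> x) *\<^sub>R u x)) (at x)"
    using Z_ae AE_space
  proof eventually_elim
    case (elim x)
    then have x: "l < x" "x < r"
      by auto
    let ?H = "inf (at x) (ae_filter lebesgue)"
    have Zlim: "(Z \<longlongrightarrow> Z x) ?H"
      using elim by blast
    have "isCont u x" "isCont p x"
      using cont x by (auto intro: continuous_on_interior simp: interior_atLeastAtMost_real)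
    then have lim: "(u \<longlongrightarrow> u x) ?H" "(p \<longlongrightarrow> p x) ?H"
      by (auto simp: isCont_def intro: tendsto_mono[OF inf_le1])
    \<comment> \<open>\<open>Z\<close> is essentially continuous at almost every \<open>x\<close>
      and \<open>y\<close> is continuous, so the integrand inherits essential continuity and the
      integral equation can be differentiated there.\<close>
    have "((\<lambda>t. G t (y t)) \<longlongrightarrow> G x (y x)) ?H"
      unfolding G_def u_def[symmetric] p_def[symmetric]
      using Z_pos[of x] by (intro tendsto_intros Zlim lim) auto
    then have "((\<lambda>v. integral {v..r} (\<lambda>t. G t (y t))) has_vector_derivative - G x (y x)) (at x)"
      by (rule integral_has_vector_derivative_ess_continuous[OF G_int[OF y] x])
    from has_vector_derivative_diff[OF has_vector_derivative_const[of "(c0, c1)"] this]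
    have "((\<lambda>v. (c0, c1) - integral {v..r} (\<lambda>t. G t (y t))) has_vector_derivative G x (y x)) (at x)"
      by simp
    then have "(y has_vector_derivative G x (y x)) (at x)"
      by (rule has_vector_derivative_transform_within_open[of _ _ _ "{l<..<r}"]) (use x y_eq in auto)
    then have "((\<lambda>t. fst (y t)) has_vector_derivative fst (G x (y x))) (at x)"
      "((\<lambda>t. snd (y t)) has_vector_derivative snd (G x (y x))) (at x)"
      by (rule bounded_linear.has_vector_derivative[OF bounded_linear_fst]
          bounded_linear.has_vector_derivative[OF bounded_linear_snd])+
    moreover have "Z x = \<zeta> x"
      using elim by blast
    ultimately show ?case
      unfolding fun_eq by (simp add: G_def)
  qed
  with ac have "ode_pair l r \<zeta> \<omega> u p"
    by (simp add: ode_pair_def)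
  moreover have "y r = (c0, c1)"
    using y_eq[of r] lr by simp
  then have "(u \<longlongrightarrow> c0) (at_left r)" "(p \<longlongrightarrow> c1) (at_left r)"
    using continuous_on_Icc_at_leftD[OF cont(1) lr] continuous_on_Icc_at_leftD[OF cont(2) lr]
    by (simp_all add: u_def p_def)
  moreover have "(u \<longlongrightarrow> u l) (at_right l)" "(p \<longlongrightarrow> p l) (at_right l)"
    using continuous_on_Icc_at_rightD[OF cont(1) lr] continuous_on_Icc_at_rightD[OF cont(2) lr] by auto
  ultimately show ?thesis
    by (rule that)
qed

lemma u_left_tendsto_right:
  assumes "ode_pair l r \<zeta> \<omega> u p" "(u \<longlongrightarrow> a) (at_right l)" "(p \<longlongrightarrow> b) (at_right l)" "\<nu> \<noteq> 0"
  shows "(u_left \<nu> u \<longlongrightarrow> (a - (b /\<^sub>R z0) / (\<i> * complex_of_real \<nu>)) / 2) (ess_at_right l)"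
proof (rule Lim_transform_eventually)
  have "(u \<longlongrightarrow> a) (ess_at_right l)" "(p \<longlongrightarrow> b) (ess_at_right l)"
    using assms by (auto simp: ess_at_right_def intro: tendsto_mono[OF inf_le1])
  then show "((\<lambda>x. (u x - (p x /\<^sub>R \<zeta> x) / (\<i> * complex_of_real \<nu>)) / 2) \<longlongrightarrow>
      (a - (b /\<^sub>R z0) / (\<i> * complex_of_real \<nu>)) / 2) (ess_at_right l)"
    using z0 assms(4) by (intro tendsto_intros) auto
  show "\<forall>\<^sub>F x in ess_at_right l. (u x - (p x /\<^sub>R \<zeta> x) / (\<i> * complex_of_real \<nu>)) / 2 = u_left \<nu> u x"
    using eventually_ess_at_rightI[OF ode_pair_u_left[OF assms(1), of \<nu>] lr] by eventually_elim simp
qed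

lemma u_left_tendsto_left:
  assumes "ode_pair l r \<zeta> \<omega> u p" "(u \<longlongrightarrow> a) (at_left r)" "(p \<longlongrightarrow> b) (at_left r)" "\<nu> \<noteq> 0"
  shows "(u_left \<nu> u \<longlongrightarrow> (a - (b /\<^sub>R z1) / (\<i> * complex_of_real \<nu>)) / 2) (ess_at_left r)"
proof (rule Lim_transform_eventually)
  have "(u \<longlongrightarrow> a) (ess_at_left r)" "(p \<longlongrightarrow> b) (ess_at_left r)"
    using assms by (auto simp: ess_at_left_def intro: tendsto_mono[OF inf_le1])
  then show "((\<lambda>x. (u x - (p x /\<^sub>R \<zeta> x) / (\<i> * complex_of_real \<nu>)) / 2) \<longlongrightarrow>
      (a - (b /\<^sub>R z1) / (\<i> * complex_of_real \<nu>)) / 2) (ess_at_left r)"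
    using z1 assms(4) by (intro tendsto_intros) auto
  show "\<forall>\<^sub>F x in ess_at_left r. (u x - (p x /\<^sub>R \<zeta> x) / (\<i> * complex_of_real \<nu>)) / 2 = u_left \<nu> u x"
    using eventually_ess_at_leftI[OF ode_pair_u_left[OF assms(1), of \<nu>] lr] by eventually_elim simp
qed

lemma ode_pair_with_outgoing_data:
  obtains u p a b where "ode_pair l r \<zeta> \<omega> u p"
    "(u_right \<omega> u \<longlongrightarrow> \<rho>) (ess_at_left r)" "(u_left \<omega> u \<longlongrightarrow> \<sigma>) (ess_at_left r)"
    "(u_right \<omega> u \<longlongrightarrow> a) (ess_at_right l)" "(u_left \<omega> u \<longlongrightarrow> b) (ess_at_right l)"
proof -
  \<comment> \<open>Inverting the definition of the amplitudes gives u = u^r + u^l and u' = \<i>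
    \<omega> (u^r - u^l); the factor \<open>z1\<close> turns u' into the end value of
    \<open>p\<close>.\<close>
  define c1 where "c1 = z1 *\<^sub>R (\<i> * complex_of_real \<omega> * (\<rho> - \<sigma>))"
  obtain u p d0 d1 where u: "ode_pair l r \<zeta> \<omega> u p"
    and lim: "(u \<longlongrightarrow> \<rho> + \<sigma>) (at_left r)" "(p \<longlongrightarrow> c1) (at_left r)"
    "(u \<longlongrightarrow> d0) (at_right l)" "(p \<longlongrightarrow> d1) (at_right l)"
    by (rule ode_pair_exists)
  have c1: "c1 /\<^sub>R z1 = \<i> * complex_of_real \<omega> * (\<rho> - \<sigma>)"
    using z1 by (simp add: c1_def)
  have "(\<rho> + \<sigma> - (c1 /\<^sub>R z1) / (\<i> * complex_of_real \<omega>)) / 2 = \<sigma>"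
    unfolding c1 using \<omega> by (simp add: field_simps)
  with u_left_tendsto_left[OF u lim(1,2) \<omega>] have "(u_left \<omega> u \<longlongrightarrow> \<sigma>) (ess_at_left r)"
    by (simp only:)
  moreover have "(\<rho> + \<sigma> - (c1 /\<^sub>R z1) / (\<i> * complex_of_real (- \<omega>))) / 2 = \<rho>"
    unfolding c1 using \<omega> by (simp add: field_simps)
  with u_left_tendsto_left[OF u lim(1,2), of "- \<omega>"] \<omega> have "(u_right \<omega> u \<longlongrightarrow> \<rho>) (ess_at_left r)"
    by (simp only: u_right_eq_u_left neg_equal_0_iff_equal not_False_eq_True)
  moreover have "\<exists>a. (u_right \<omega> u \<longlongrightarrow> a) (ess_at_right l)" "\<exists>b. (u_left \<omega> u \<longlongrightarrow> b) (ess_at_right l)"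
    using u_left_tendsto_right[OF u lim(3,4), of \<omega>] u_left_tendsto_right[OF u lim(3,4), of "- \<omega>"] \<omega>
    by (auto simp: u_right_eq_u_left)
  ultimately show ?thesis
    using that u by blast
qed

section \<open>Transfer of boundary data from the right end to the left end\<close>

lemma tendsto_lincomb:
  assumes "ode_pair l r \<zeta> \<omega> u p" "ode_pair l r \<zeta> \<omega> v q"
  shows "(u_left \<nu> u \<longlongrightarrow> c) (ess_at_right l) \<Longrightarrow> (u_left \<nu> v \<longlongrightarrow> d) (ess_at_right l) \<Longrightarrow>
      (u_left \<nu> (\<lambda>x. a * u x + b * v x) \<longlongrightarrow> a * c + b * d) (ess_at_right l)"
    and "(u_left \<nu> u \<longlongrightarrow> c) (ess_at_left r) \<Longrightarrow> (u_left \<nu> v \<longlongrightarrow> d) (ess_at_left r) \<Longrightarrow>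
      (u_left \<nu> (\<lambda>x. a * u x + b * v x) \<longlongrightarrow> a * c + b * d) (ess_at_left r)"
proof -
  note AE = ode_pair_u_left_lincomb[OF assms, of \<nu> a b]
  have R: "\<forall>\<^sub>F x in ess_at_right l. a * u_left \<nu> u x + b * u_left \<nu> v x = u_left \<nu> (\<lambda>x. a * u x + b * v x) x"
    using eventually_ess_at_rightI[OF AE lr] by eventually_elim simp
  have L: "\<forall>\<^sub>F x in ess_at_left r. a * u_left \<nu> u x + b * u_left \<nu> v x = u_left \<nu> (\<lambda>x. a * u x + b * v x) x"
    using eventually_ess_at_leftI[OF AE lr] by eventually_elim simp
  show "(u_left \<nu> (\<lambda>x. a * u x + b * v x) \<longlongrightarrow> a * c + b * d) (ess_at_right l)"
    if "(u_left \<nu> u \<longlongrightarrow> c) (ess_at_right l)" "(u_left \<nu> v \<longlongrightarrow> d) (ess_at_right l)"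
    by (rule Lim_transform_eventually[OF _ R]) (intro tendsto_intros that)
  show "(u_left \<nu> (\<lambda>x. a * u x + b * v x) \<longlongrightarrow> a * c + b * d) (ess_at_left r)"
    if "(u_left \<nu> u \<longlongrightarrow> c) (ess_at_left r)" "(u_left \<nu> v \<longlongrightarrow> d) (ess_at_left r)"
    by (rule Lim_transform_eventually[OF _ L]) (intro tendsto_intros that)
qed

lemma flux_boundary:
  assumes "ode_pair l r \<zeta> \<omega> u p"
    and "(u_right \<omega> u \<longlongrightarrow> r0) (ess_at_right l)" "(u_left \<omega> u \<longlongrightarrow> l0) (ess_at_right l)"
    and "(u_right \<omega> u \<longlongrightarrow> r1) (ess_at_left r)" "(u_left \<omega> u \<longlongrightarrow> l1) (ess_at_left r)"
  shows "z0 * ((norm r0)\<^sup>2 - (norm l0)\<^sup>2) = z1 * ((norm r1)\<^sup>2 - (norm l1)\<^sup>2)"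
  by (rule ode_pair_flux_boundary[OF assms(1) lr _ \<omega> z0(2) assms(2,3) z1(2) assms(4,5)]) (rule pos)

lemma is_solution_iff:
  "is_solution l r \<zeta> \<omega> \<xi> u \<longleftrightarrow> (\<exists>p. ode_pair l r \<zeta> \<omega> u p) \<and>
    (u_right \<omega> u \<longlongrightarrow> 1) (ess_at_right l) \<and>
    (\<exists>c. (u_right \<omega> u \<longlongrightarrow> c) (ess_at_left r) \<and> (u_left \<omega> u \<longlongrightarrow> \<xi> * c) (ess_at_left r))"
  by (rule is_solution_iff_ode_pair) (rule pos)

text \<open>The difference of two solutions has u^r = 0 at the left end, so its flux there is at
  most 0, while at the right end it is at least 0 because |\<xi>| \<le> 1. Hence u^l of the
  difference vanishes at the left end too. This is the uniqueness that the definite description in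
  \<open>g_map\<close> requires.\<close>

lemma reflection_unique:
  assumes \<xi>: "norm \<xi> \<le> 1"
    and u: "is_solution l r \<zeta> \<omega> \<xi> u" "(u_left \<omega> u \<longlongrightarrow> w) (ess_at_right l)"
    and v: "is_solution l r \<zeta> \<omega> \<xi> v" "(u_left \<omega> v \<longlongrightarrow> w') (ess_at_right l)"
  shows "w = w'"
proof -
  obtain p c where p: "ode_pair l r \<zeta> \<omega> u p" "(u_right \<omega> u \<longlongrightarrow> 1) (ess_at_right l)"
    "(u_right \<omega> u \<longlongrightarrow> c) (ess_at_left r)" "(u_left \<omega> u \<longlongrightarrow> \<xi> * c) (ess_at_left r)"
    using u(1) unfolding is_solution_iff by blast
  obtain q d where q: "ode_pair l r \<zeta> \<omega> v q" "(u_right \<omega> v \<longlongrightarrow> 1) (ess_at_right l)"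
    "(u_right \<omega> v \<longlongrightarrow> d) (ess_at_left r)" "(u_left \<omega> v \<longlongrightarrow> \<xi> * d) (ess_at_left r)"
    using v(1) unfolding is_solution_iff by blast
  note L = tendsto_lincomb[OF p(1) q(1), where a=1 and b="-1" and \<nu>=\<omega>]
    and R = tendsto_lincomb[OF p(1) q(1), where a=1 and b="-1" and \<nu>="- \<omega>", folded u_right_eq_u_left]
  have flux: "z0 * ((norm (1 * 1 + - 1 * 1 :: complex))\<^sup>2 - (norm (1 * w + - 1 * w'))\<^sup>2) =
      z1 * ((norm (1 * c + - 1 * d))\<^sup>2 - (norm (1 * (\<xi> * c) + - 1 * (\<xi> * d)))\<^sup>2)"
    by (rule flux_boundary[OF ode_pair_lincomb[OF p(1) q(1)] R(1)[OF p(2) q(2)] L(1)[OF u(2) v(2)]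
        R(2)[OF p(3) q(3)] L(2)[OF p(4) q(4)]])
  have eqs: "1 * w + - 1 * w' = w - w'" "1 * c + - 1 * d = c - d" "1 * (\<xi> * c) + - 1 * (\<xi> * d) = \<xi> * (c - d)"
    by (simp_all add: algebra_simps)
  have "- z0 * (norm (w - w'))\<^sup>2 = z1 * ((norm (c - d))\<^sup>2 * (1 - (norm \<xi>)\<^sup>2))"
    using flux unfolding eqs norm_mult power_mult_distrib by (simp add: algebra_simps)
  moreover have "\<dots> \<ge> 0"
    using \<xi> z1 by (intro mult_nonneg_nonneg) (auto simp: abs_square_le_1)
  moreover have "z0 * (norm (w - w'))\<^sup>2 \<ge> 0"
    using z0 by simp
  ultimately have "z0 * (norm (w - w'))\<^sup>2 = 0"
    by linarith
  then show ?thesis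
    using z0 by simp
qed

text \<open>The pairs (\<alpha>, \<beta>) and (\<gamma>, \<delta>) are the columns of the transfer
  matrix: the left-end amplitudes of the solutions with right-end amplitudes (1, 0) and (0,
  1).\<close>

lemma g_map_Aut_disk: "g_map l r \<zeta> \<omega> \<in> Aut_disk"
proof -
  obtain u p \<alpha> \<beta> where u: "ode_pair l r \<zeta> \<omega> u p"
    "(u_right \<omega> u \<longlongrightarrow> 1) (ess_at_left r)" "(u_left \<omega> u \<longlongrightarrow> 0) (ess_at_left r)"
    "(u_right \<omega> u \<longlongrightarrow> \<alpha>) (ess_at_right l)" "(u_left \<omega> u \<longlongrightarrow> \<beta>) (ess_at_right l)"
    by (rule ode_pair_with_outgoing_data)
  obtain v q \<gamma> \<delta> where v: "ode_pair l r \<zeta> \<omega> v q"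
    "(u_right \<omega> v \<longlongrightarrow> 0) (ess_at_left r)" "(u_left \<omega> v \<longlongrightarrow> 1) (ess_at_left r)"
    "(u_right \<omega> v \<longlongrightarrow> \<gamma>) (ess_at_right l)" "(u_left \<omega> v \<longlongrightarrow> \<delta>) (ess_at_right l)"
    by (rule ode_pair_with_outgoing_data)
  have comb: "ode_pair l r \<zeta> \<omega> (\<lambda>x. a * u x + b * v x) (\<lambda>x. a * p x + b * q x)"
    "(u_right \<omega> (\<lambda>x. a * u x + b * v x) \<longlongrightarrow> a) (ess_at_left r)"
    "(u_left \<omega> (\<lambda>x. a * u x + b * v x) \<longlongrightarrow> b) (ess_at_left r)"
    "(u_right \<omega> (\<lambda>x. a * u x + b * v x) \<longlongrightarrow> a * \<alpha> + b * \<gamma>) (ess_at_right l)"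
    "(u_left \<omega> (\<lambda>x. a * u x + b * v x) \<longlongrightarrow> a * \<beta> + b * \<delta>) (ess_at_right l)" for a b
    using ode_pair_lincomb[OF u(1) v(1)]
      tendsto_lincomb(1)[OF u(1) v(1) u(5) v(5)]
      tendsto_lincomb(1)[OF u(1) v(1) u(4)[unfolded u_right_eq_u_left] v(4)[unfolded u_right_eq_u_left]]
      tendsto_lincomb(2)[OF u(1) v(1) u(3) v(3), where a=a and b=b]
      tendsto_lincomb(2)[OF u(1) v(1) u(2)[unfolded u_right_eq_u_left] v(2)[unfolded u_right_eq_u_left],
        where a=a and b=b]
    by (simp_all add: u_right_eq_u_left)
  \<comment> \<open>Flux conservation for all right-end data (a, b); the cases (1, \<xi>) and (0, 1)
    are the hypotheses of \<open>moebius_Aut_disk\<close> with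
    \<open>\<kappa> = z1 / z0\<close>.\<close>
  have flux: "z0 * ((norm (a * \<alpha> + b * \<gamma>))\<^sup>2 - (norm (a * \<beta> + b * \<delta>))\<^sup>2) = z1 * ((norm a)\<^sup>2 - (norm b)\<^sup>2)" for a b
    by (rule flux_boundary[OF comb(1)[of a b] comb(4,5,2,3)])
  have "z1 / z0 > 0"
    using z0 z1 by simp
  moreover have "(norm (\<alpha> + \<xi> * \<gamma>))\<^sup>2 - (norm (\<beta> + \<xi> * \<delta>))\<^sup>2 = z1 / z0 * (1 - (norm \<xi>)\<^sup>2)" for \<xi>
    using flux[of 1 \<xi>] z0 by (simp add: field_simps)
  moreover have "(norm \<gamma>)\<^sup>2 - (norm \<delta>)\<^sup>2 = - (z1 / z0)"
    using flux[of 0 1] z0 by (simp add: field_simps)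
  ultimately have nz: "\<And>\<xi>. \<xi> \<in> disk \<Longrightarrow> \<alpha> + \<xi> * \<gamma> \<noteq> 0"
    and Aut: "(\<lambda>\<xi>. (\<beta> + \<xi> * \<delta>) / (\<alpha> + \<xi> * \<gamma>)) \<in> Aut_disk"
    using moebius_Aut_disk by blast+
  have g: "g_map l r \<zeta> \<omega> \<xi> = (\<beta> + \<xi> * \<delta>) / (\<alpha> + \<xi> * \<gamma>)" if \<xi>: "\<xi> \<in> disk" for \<xi>
  proof -
    \<comment> \<open>The factor \<open>k\<close> normalises u^r to 1 at the left end; the right-end
      amplitudes become (k, k \<xi>), which is the boundary condition.\<close>
    define k where "k = inverse (\<alpha> + \<xi> * \<gamma>)"
    define U where "U = (\<lambda>x. k * u x + (k * \<xi>) * v x)"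
    have k: "k * \<alpha> + k * \<xi> * \<gamma> = 1" "k * \<beta> + k * \<xi> * \<delta> = (\<beta> + \<xi> * \<delta>) / (\<alpha> + \<xi> * \<gamma>)"
    proof -
      have "k * \<alpha> + k * \<xi> * \<gamma> = k * (\<alpha> + \<xi> * \<gamma>)" "k * \<beta> + k * \<xi> * \<delta> = k * (\<beta> + \<xi> * \<delta>)"
        by (simp_all add: algebra_simps)
      then show "k * \<alpha> + k * \<xi> * \<gamma> = 1" "k * \<beta> + k * \<xi> * \<delta> = (\<beta> + \<xi> * \<delta>) / (\<alpha> + \<xi> * \<gamma>)"
        using nz[OF \<xi>] by (simp_all add: k_def divide_inverse mult.commute)
    qed
    note U = comb[of k "k * \<xi>", folded U_def]
    have "(u_left \<omega> U \<longlongrightarrow> \<xi> * k) (ess_at_left r)"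
      using U(3) by (simp only: mult.commute)
    then have sol: "is_solution l r \<zeta> \<omega> \<xi> U"
      unfolding is_solution_iff using U(1,2) U(4)[unfolded k] by blast
    have lim: "(u_left \<omega> U \<longlongrightarrow> (\<beta> + \<xi> * \<delta>) / (\<alpha> + \<xi> * \<gamma>)) (ess_at_right l)"
      using U(5)[unfolded k] .
    have "\<exists>u. is_solution l r \<zeta> \<omega> \<xi> u \<and> (u_left \<omega> u \<longlongrightarrow> (\<beta> + \<xi> * \<delta>) / (\<alpha> + \<xi> * \<gamma>)) (ess_at_right l)"
      using sol lim by (intro exI[of _ U] conjI)
    then show ?thesis
      unfolding g_map_def
    proof (rule the_equality)
      fix w assume "\<exists>u. is_solution l r \<zeta> \<omega> \<xi> u \<and> (u_left \<omega> u \<longlongrightarrow> w) (ess_at_right l)"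
      then show "w = (\<beta> + \<xi> * \<delta>) / (\<alpha> + \<xi> * \<gamma>)"
        using reflection_unique[OF _ _ _ sol lim] \<xi> by auto
    qed
  qed
  \<comment> \<open>The formula for \<open>g_map\<close> is known on the disk alone, so both
    defining properties are transferred by congruence on the disk.\<close>
  have "g_map l r \<zeta> \<omega> holomorphic_on disk \<longleftrightarrow> (\<lambda>\<xi>. (\<beta> + \<xi> * \<delta>) / (\<alpha> + \<xi> * \<gamma>)) holomorphic_on disk"
    by (rule holomorphic_cong) (simp_all add: g)
  moreover have "bij_betw (g_map l r \<zeta> \<omega>) disk disk \<longleftrightarrow>
      bij_betw (\<lambda>\<xi>. (\<beta> + \<xi> * \<delta>) / (\<alpha> + \<xi> * \<gamma>)) disk disk"
    by (rule bij_betw_cong) (rule g)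
  ultimately show ?thesis
    using Aut unfolding Aut_disk_def by simp
qed

end

theorem theorem2:
  fixes x0 x1 \<omega> :: real and \<zeta> :: "real \<Rightarrow> real"
  assumes "x0 < x1"
    and "\<zeta> \<in> Reg_plus {x0<..<x1}"
    and "\<omega> \<notin> Sigma_exc {x0<..<x1} \<zeta>"
  shows "g_map x0 x1 \<zeta> \<omega> \<in> Aut_disk_closure \<and>
    (ess_bounded_variation_on {x0<..<x1} \<zeta> \<longrightarrow>
       g_map x0 x1 \<zeta> \<omega> \<in> Aut_disk \<and> \<not> g_map x0 x1 \<zeta> \<omega> constant_on disk)"
proof -
  obtain m M z0 z1 where \<zeta>: "m > 0" "\<And>x. x \<in> {x0<..<x1} \<Longrightarrow> m < \<zeta> x"
    "AE x in lebesgue_on {x0<..<x1}. \<zeta> x \<le> M" "\<zeta> \<in> borel_measurable (lebesgue_on {x0<..<x1})"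
    "z0 > 0" "(\<zeta> \<longlongrightarrow> z0) (ess_at_right x0)" "z1 > 0" "(\<zeta> \<longlongrightarrow> z1) (ess_at_left x1)"
    "AE x in lebesgue_on {x0<..<x1}. (\<zeta> \<longlongrightarrow> \<zeta> x) (inf (at x) (ae_filter lebesgue))"
    by (rule Reg_plusE[OF assms(2,1)]) (rule that; assumption)
  have "0 < \<zeta> x" if "x \<in> {x0<..<x1}" for x
    using \<zeta>(1) \<zeta>(2)[OF that] by simp
  then have "0 \<in> Sigma_exc {x0<..<x1} \<zeta>"
    using assms \<zeta>(3,4) by (intro zero_in_Sigma_exc[where M=M]) auto
  with assms(3) have "\<omega> \<noteq> 0"
    by blast
  then interpret regulated_impedance x0 x1 \<omega> m M z0 z1 \<zeta>
    by unfold_locales (use assms \<zeta> in auto)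
  have "g_map x0 x1 \<zeta> \<omega> \<in> Aut_disk_closure"
    \<comment> \<open>An automorphism approximates itself on every compact set.\<close>
    unfolding Aut_disk_closure_def mem_Collect_eq
    by (intro allI impI bexI[OF _ g_map_Aut_disk]) simp
  moreover have "\<not> g_map x0 x1 \<zeta> \<omega> constant_on disk"
  proof
    assume "g_map x0 x1 \<zeta> \<omega> constant_on disk"
    then obtain c where "\<And>\<xi>. \<xi> \<in> disk \<Longrightarrow> g_map x0 x1 \<zeta> \<omega> \<xi> = c"
      unfolding constant_on_def by blast
    \<comment> \<open>Two distinct points of the disk with equal values contradict
      injectivity.\<close>
    then have eq: "g_map x0 x1 \<zeta> \<omega> 0 = g_map x0 x1 \<zeta> \<omega> (1 / 2)"
      by (simp add: norm_divide)
    have inj: "inj_on (g_map x0 x1 \<zeta> \<omega>) disk"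
      using g_map_Aut_disk by (simp add: Aut_disk_def bij_betw_def)
    show False
      using inj_onD[OF inj eq] by (simp add: norm_divide)
  qed
  moreover note g_map_Aut_disk
  ultimately show ?thesis
    by blast
qed

end
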